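(* Let $(E,\rho,[\cdot,\cdot]_E,L)$ be a regular local pre-Leibniz algebroid with a locality projector $\mathcal{P}$, and let $\nabla$ be an admissible linear $E$-connection. Then, on any local $E$-frame $(X_a)$ with dual coframe $(e^a)$, the following differential Bianchi identities hold: $$\hat d(\nabla)\hat T^a(\nabla)+\omega^a{}_b(\nabla)\wedge\hat T^b(\nabla)=R^a{}_b(\nabla)\wedge e^b+\hat d(\nabla)^2e^a,$$ $$\hat d(\nabla)R^a{}_b(\nabla)+\omega^a{}_c(\nabla)\wedge R^c{}_b(\nabla)=R^a{}_c(\nabla)\wedge\omega^c{}_b(\nabla)+\hat d(\nabla)^2\omega^a{}_b(\nabla).$$
   Context: Everything is smooth. $M$ is a manifold, $E\to M$ a real vector bundle of constant rank, $\mathfrak{X}(E)=\Gamma(E)$, $\Omega^p(E)=\Gamma(\Lambda^pE^* )$. An anchored vector bundle $(E,\rho)$ has a vector bundle morphism $\rho:E\to T(M)$ over the identity; it is regular if $\ker\rho$ has locally constant rank. A pre-Leibniz algebroid $(E,\rho,[\cdot,\cdot]_E)$ is an anchored vector bundle with an $\mathbb{R}$-bilinear bracket on $\mathfrak{X}(E)$ satisfying $[u,fv]_E=\rho(u)(f)v+f[u,v]_E$ and $\rho([u,v]_E)=[\rho(u),\rho(v)]$. It is local with locality operator $L$, a $C^\infty(M,\mathbb{R})$-multilinear map $L:\Omega^1(E)\times\mathfrak{X}(E)\times\mathfrak{X}(E)\to\mathfrak{X}(E)$, if $[fu,v]_E=-\rho(v)(f)u+f[u,v]_E+L(Df,u,v)$,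 where $(Df)(u):=\rho(u)(f)$. A locality projector is a $C^\infty(M,\mathbb{R})$-linear map $\mathcal{P}:\mathfrak{X}(E)\to\mathfrak{X}(E)$ such that the image of $\mathcal{P}L$ lies in $\ker\rho$ and $\mathcal{P}$ restricts to the identity on $\ker\rho$. A linear $E$-connection is an $\mathbb{R}$-bilinear map $\nabla:\mathfrak{X}(E)\times\mathfrak{X}(E)\to\mathfrak{X}(E)$ with $\nabla_u(fv)=\rho(u)(f)v+f\nabla_uv$ and $\nabla_{fu}v=f\nabla_uv$. Repeated indices are summed; $L(e^a,\nabla_{X_a}u,v)$ does not depend on the frame. $\nabla$ is admissible if $[u,v]_E+[v,u]_E=L(e^a,\nabla_{X_a}u,v)+L(e^a,\nabla_{X_a}v,u)$ for all $u,v$. Projected modified bracket: $[u,v]_E^{\hat\nabla}:=[u,v]_E-\mathcal{P}L(e^a,\nabla_{X_a}u,v)$ (anti-symmetric for admissible $\nabla$). Projected $E$-torsion: $\hat T(\nabla)(u,v):=\nabla_uv-\nabla_vu-[u,v]_E^{\hat\nabla}$. $E$-curvature: $R(\nabla)(u,v)w:=\nabla_u\nabla_vw-\nabla_v\nabla_uw-\nabla_{[u,v]_E^{\hat\nabla}}w$. The forms: $\hat T^a(\nabla)(u,v):=\langle e^a,\hat T(\nabla)(u,v)\rangle$, $R^a{}_b(\nabla)(u,v):=\langle e^a,R(\nabla)(u,v)X_b\rangle$, $\omega^a{}_b(\nabla)(v):=\langle e^a,\nabla_vX_b\rangle$. The projected $E$-exterior derivative $\hat d(\nabla):\Omega^p(E)\to\Omega^{p+1}(E)$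 is $$\hat d(\nabla)\Omega(v_1,\dots,v_{p+1}):=\sum_i(-1)^{i+1}\rho(v_i)\big(\Omega(v_1,\dots,\check v_i,\dots,v_{p+1})\big)+\sum_{i<j}(-1)^{i+j}\Omega([v_i,v_j]_E^{\hat\nabla},v_1,\dots,\check v_i,\dots,\check v_j,\dots,v_{p+1}),$$ where $\check v_i$ means omitted. Its square need not vanish. Convention: $(\alpha\wedge\beta)(u,v)=\alpha(u)\beta(v)-\alpha(v)\beta(u)$ for 1-forms (and the corresponding convention in higher degree). *)

theory Defs
  imports
    "HOL-Analysis.Analysis"
    "HOL-Library.Function_Algebras"
    "HOL-Combinatorics.Permutations"
begin

section \<open>Smooth manifolds\<close>

text \<open>
  On an open subset of a finite-dimensional space, \<open>C\<^sup>k\<^sup>+\<^sup>1\<close> means: differentiable, with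
  all directional derivatives \<open>C\<^sup>k\<close>. The predicates below are only applied to open sets.
\<close>

primrec Ck_on :: "nat \<Rightarrow> 'a::real_normed_vector set \<Rightarrow> ('a \<Rightarrow> 'b::real_normed_vector) \<Rightarrow> bool" where
  "Ck_on 0 S f \<longleftrightarrow> continuous_on S f"
| "Ck_on (Suc k) S f \<longleftrightarrow>
     (\<forall>x\<in>S. f differentiable (at x)) \<and> (\<forall>v. Ck_on k S (\<lambda>x. frechet_derivative f (at x) v))"

definition smooth_on :: "'a::real_normed_vector set \<Rightarrow> ('a \<Rightarrow> 'b::real_normed_vector) \<Rightarrow> bool" where
  "smooth_on S f \<longleftrightarrow> (\<forall>k. Ck_on k S f)"

text \<open>
  The manifold is the whole type \<open>'m\<close>. The model space is an arbitrary finite-dimensional inner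
  product space; class \<open>euclidean_space\<close> would exclude dimension zero. A chart is a pair of
  an open set and a map that matters only on that set; an atlas need not be maximal.
\<close>

type_synonym ('m, 'a) chart = "'m set \<times> ('m \<Rightarrow> 'a)"

definition smooth_manifold ::
  "('m::{t2_space,second_countable_topology}, 'a::real_inner) chart set \<Rightarrow> bool" where
  "smooth_manifold \<A> \<longleftrightarrow>
     (\<exists>B::'a set. finite B \<and> span B = UNIV) \<and>
     (\<Union>(U, \<phi>)\<in>\<A>. U) = UNIV \<and>
     (\<forall>(U, \<phi>)\<in>\<A>. open U \<and> open (\<phi> ` U) \<and> (\<exists>\<psi>. homeomorphism U (\<phi> ` U) \<phi> \<psi>)) \<and>
     (\<forall>(U, \<phi>)\<in>\<A>. \<forall>(V, \<psi>)\<in>\<A>. smooth_on (\<phi> ` (U \<inter> V)) (\<psi> \<circ> inv_into U \<phi>))"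

definition smooth_funs ::
  "('m::topological_space, 'a::real_inner) chart set \<Rightarrow> 'm set \<Rightarrow> ('m \<Rightarrow> real) set" where
  "smooth_funs \<A> W = {f. \<forall>(U, \<phi>)\<in>\<A>. smooth_on (\<phi> ` (U \<inter> W)) (f \<circ> inv_into U \<phi>)}"

text \<open>
  The tangent space at \<open>p\<close>, as derivations at \<open>p\<close> of \<open>C\<^sup>\<infinity>(M)\<close>. The last clause fixes the
  values outside \<open>C\<^sup>\<infinity>(M)\<close>, so that tangent vectors are equal iff they are equal as functions.
  Sums and products of functions are pointwise.
\<close>

definition tangent_space ::
  "('m::topological_space, 'a::real_inner) chart set \<Rightarrow> 'm \<Rightarrow> (('m \<Rightarrow> real) \<Rightarrow> real) set" where
  "tangent_space \<A> p = {D.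
     (\<forall>f\<in>smooth_funs \<A> UNIV. \<forall>g\<in>smooth_funs \<A> UNIV. \<forall>c.
        D (f + g) = D f + D g \<and>
        D (\<lambda>q. c * f q) = c * D f \<and>
        D (f * g) = D f * g p + f p * D g) \<and>
     (\<forall>f. f \<notin> smooth_funs \<A> UNIV \<longrightarrow> D f = 0)}"

section \<open>Vector bundles\<close>

text \<open>
  The fibres are subspaces of a real vector space \<open>'v\<close> that carries no topology: the smooth
  structure comes only from the local trivializations, so every vector bundle has this form up to
  isomorphism (take for \<open>'v\<close> the direct sum of all fibres). A trivialization over \<open>U\<close> sends
  \<open>e\<close> in the fibre over \<open>p \<in> U\<close> to its coordinates \<open>\<Phi> p e i\<close>, \<open>i < rk\<close>.
\<close>

record ('m, 'a, 'v) vbundle =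
  atlas :: "('m, 'a) chart set"
  rk :: nat
  fibre :: "'m \<Rightarrow> 'v set"
  trivs :: "('m set \<times> ('m \<Rightarrow> 'v \<Rightarrow> nat \<Rightarrow> real)) set"

definition linear_over :: "'v::real_vector set \<Rightarrow> ('v \<Rightarrow> real) \<Rightarrow> bool" where
  "linear_over F l \<longleftrightarrow>
     (\<forall>x\<in>F. \<forall>y\<in>F. l (x + y) = l x + l y) \<and> (\<forall>x\<in>F. \<forall>c. l (c *\<^sub>R x) = c * l x)"

definition vector_bundle ::
  "('m::{t2_space,second_countable_topology}, 'a::real_inner, 'v::real_vector, 'z) vbundle_scheme \<Rightarrow> bool" where
  "vector_bundle E \<longleftrightarrow>
     smooth_manifold (atlas E) \<and>
     (\<forall>p. subspace (fibre E p)) \<and>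
     (\<Union>(U, \<Phi>)\<in>trivs E. U) = UNIV \<and>
     (\<forall>(U, \<Phi>)\<in>trivs E. open U \<and>
        (\<forall>p\<in>U. (\<forall>i<rk E. linear_over (fibre E p) (\<lambda>e. \<Phi> p e i)) \<and>
           bij_betw (\<lambda>e. restrict (\<Phi> p e) {..<rk E}) (fibre E p) ({..<rk E} \<rightarrow>\<^sub>E UNIV))) \<and>
     (\<forall>(U, \<Phi>)\<in>trivs E. \<forall>(V, \<Psi>)\<in>trivs E. \<exists>g.
        (\<forall>i<rk E. \<forall>j<rk E. g i j \<in> smooth_funs (atlas E) (U \<inter> V)) \<and>
        (\<forall>p\<in>U \<inter> V. \<forall>e\<in>fibre E p. \<forall>i<rk E. \<Psi> p e i = (\<Sum>j<rk E. g i j p * \<Phi> p e j)))"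

text \<open>
  Smooth sections over an open set \<open>W\<close>; values outside \<open>W\<close> are irrelevant.
\<close>

definition sections ::
  "('m::topological_space, 'a::real_inner, 'v::real_vector, 'z) vbundle_scheme \<Rightarrow> 'm set \<Rightarrow> ('m \<Rightarrow> 'v) set" where
  "sections E W = {u. (\<forall>p\<in>W. u p \<in> fibre E p) \<and>
     (\<forall>(V, \<Phi>)\<in>trivs E. \<forall>i<rk E. (\<lambda>p. \<Phi> p (u p) i) \<in> smooth_funs (atlas E) (V \<inter> W))}"

text \<open>
  Smooth sections of the dual bundle over \<open>W\<close>, smoothness being tested on local sections of
  \<open>E\<close>. A covector is a function on all of \<open>'v\<close>, set to zero off the fibre so that it is
  determined by its values on the fibre.
\<close>

definition one_forms ::
  "('m::topological_space, 'a::real_inner, 'v::real_vector, 'z) vbundle_scheme \<Rightarrow> 'm set \<Rightarrow> ('m \<Rightarrow> 'v \<Rightarrow> real) set" where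
  "one_forms E W = {\<alpha>.
     (\<forall>p\<in>W. linear_over (fibre E p) (\<alpha> p) \<and> (\<forall>e. e \<notin> fibre E p \<longrightarrow> \<alpha> p e = 0)) \<and>
     (\<forall>V u. open V \<longrightarrow> V \<subseteq> W \<longrightarrow> u \<in> sections E V \<longrightarrow>
        (\<lambda>p. \<alpha> p (u p)) \<in> smooth_funs (atlas E) V)}"

definition fmult :: "('m \<Rightarrow> real) \<Rightarrow> ('m \<Rightarrow> 'v) \<Rightarrow> 'm \<Rightarrow> 'v::real_vector" where
  "fmult f u = (\<lambda>p. f p *\<^sub>R u p)"

definition local_frame ::
  "('m::topological_space, 'a::real_inner, 'v::real_vector, 'z) vbundle_scheme \<Rightarrow> 'm set
     \<Rightarrow> (nat \<Rightarrow> 'm \<Rightarrow> 'v) \<Rightarrow> bool" where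
  "local_frame E U X \<longleftrightarrow> open U \<and> (\<forall>a<rk E. X a \<in> sections E U) \<and>
     (\<forall>p\<in>U. inj_on (\<lambda>a. X a p) {..<rk E} \<and> independent ((\<lambda>a. X a p) ` {..<rk E}) \<and>
        span ((\<lambda>a. X a p) ` {..<rk E}) = fibre E p)"

definition dual_coframe ::
  "('m::topological_space, 'a::real_inner, 'v::real_vector, 'z) vbundle_scheme \<Rightarrow> 'm set
     \<Rightarrow> (nat \<Rightarrow> 'm \<Rightarrow> 'v) \<Rightarrow> (nat \<Rightarrow> 'm \<Rightarrow> 'v \<Rightarrow> real) \<Rightarrow> bool" where
  "dual_coframe E U X e \<longleftrightarrow> (\<forall>a<rk E. e a \<in> one_forms E U) \<and>
     (\<forall>p\<in>U. \<forall>a<rk E. \<forall>b<rk E. e a p (X b p) = (if a = b then 1 else 0))"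

section \<open>Local pre-Leibniz algebroids\<close>

record ('m, 'a, 'v) algebroid = "('m, 'a, 'v) vbundle" +
  anchor :: "'m \<Rightarrow> 'v \<Rightarrow> ('m \<Rightarrow> real) \<Rightarrow> real"
  bracket :: "('m \<Rightarrow> 'v) \<Rightarrow> ('m \<Rightarrow> 'v) \<Rightarrow> 'm \<Rightarrow> 'v"
  locop :: "('m \<Rightarrow> 'v \<Rightarrow> real) \<Rightarrow> ('m \<Rightarrow> 'v) \<Rightarrow> ('m \<Rightarrow> 'v) \<Rightarrow> 'm \<Rightarrow> 'v"

abbreviation cinf where "cinf A \<equiv> smooth_funs (atlas A) UNIV"
abbreviation gsec where "gsec A \<equiv> sections A UNIV"

text \<open>The derivative \<open>\<rho>(u)(f)\<close> of \<open>f \<in> C\<^sup>\<infinity>(M)\<close>.\<close>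

definition rho :: "('m, 'a, 'v, 'z) algebroid_scheme \<Rightarrow> ('m \<Rightarrow> 'v) \<Rightarrow> ('m \<Rightarrow> real) \<Rightarrow> 'm \<Rightarrow> real" where
  "rho A u f = (\<lambda>p. anchor A p (u p) f)"

text \<open>
  The anchor is a fibrewise linear map to the tangent bundle; it is smooth, i.e. it maps smooth
  sections to smooth vector fields, a vector field \<open>X\<close> being smooth iff \<open>X f\<close> is smooth for all
  smooth \<open>f\<close>.
\<close>

definition anchored_bundle ::
  "('m::{t2_space,second_countable_topology}, 'a::real_inner, 'v::real_vector, 'z) algebroid_scheme \<Rightarrow> bool" where
  "anchored_bundle A \<longleftrightarrow> vector_bundle A \<and>
     (\<forall>p. \<forall>e\<in>fibre A p. anchor A p e \<in> tangent_space (atlas A) p) \<and>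
     (\<forall>p f. linear_over (fibre A p) (\<lambda>e. anchor A p e f)) \<and>
     (\<forall>u\<in>gsec A. \<forall>f\<in>cinf A. rho A u f \<in> cinf A)"

definition regular ::
  "('m::topological_space, 'a, 'v::real_vector, 'z) algebroid_scheme \<Rightarrow> bool" where
  "regular A \<longleftrightarrow> (\<forall>p. \<forall>\<^sub>F q in nhds p.
     dim {e \<in> fibre A q. anchor A q e = 0} = dim {e \<in> fibre A p. anchor A p e = 0})"

definition real_bilinear_on ::
  "('m \<Rightarrow> 'v::real_vector) set \<Rightarrow> (('m \<Rightarrow> 'v) \<Rightarrow> ('m \<Rightarrow> 'v) \<Rightarrow> 'm \<Rightarrow> 'v) \<Rightarrow> bool" where
  "real_bilinear_on S B \<longleftrightarrow> (\<forall>u\<in>S. \<forall>v\<in>S. \<forall>w\<in>S. \<forall>c.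
     B (u + v) w = B u w + B v w \<and> B w (u + v) = B w u + B w v \<and>
     B (fmult (\<lambda>_. c) u) w = fmult (\<lambda>_. c) (B u w) \<and>
     B w (fmult (\<lambda>_. c) u) = fmult (\<lambda>_. c) (B w u))"

definition pre_leibniz_algebroid ::
  "('m::{t2_space,second_countable_topology}, 'a::real_inner, 'v::real_vector, 'z) algebroid_scheme \<Rightarrow> bool" where
  "pre_leibniz_algebroid A \<longleftrightarrow> anchored_bundle A \<and>
     (\<forall>u\<in>gsec A. \<forall>v\<in>gsec A. bracket A u v \<in> gsec A) \<and>
     real_bilinear_on (gsec A) (bracket A) \<and>
     (\<forall>u\<in>gsec A. \<forall>v\<in>gsec A. \<forall>f\<in>cinf A.
        bracket A u (fmult f v) = fmult (rho A u f) v + fmult f (bracket A u v)) \<and>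
     (\<forall>u\<in>gsec A. \<forall>v\<in>gsec A. \<forall>f\<in>cinf A.
        rho A (bracket A u v) f = rho A u (rho A v f) - rho A v (rho A u f))"

definition Dfun ::
  "('m, 'a, 'v, 'z) algebroid_scheme \<Rightarrow> ('m \<Rightarrow> real) \<Rightarrow> 'm \<Rightarrow> 'v \<Rightarrow> real" where
  "Dfun A f = (\<lambda>p e. if e \<in> fibre A p then anchor A p e f else 0)"

definition local_pre_leibniz_algebroid ::
  "('m::{t2_space,second_countable_topology}, 'a::real_inner, 'v::real_vector, 'z) algebroid_scheme \<Rightarrow> bool" where
  "local_pre_leibniz_algebroid A \<longleftrightarrow> pre_leibniz_algebroid A \<and>
     (\<forall>\<alpha>\<in>one_forms A UNIV. \<forall>u\<in>gsec A. \<forall>v\<in>gsec A. locop A \<alpha> u v \<in> gsec A) \<and>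
     (\<forall>\<alpha>\<in>one_forms A UNIV. \<forall>\<beta>\<in>one_forms A UNIV. \<forall>u\<in>gsec A. \<forall>v\<in>gsec A. \<forall>w\<in>gsec A. \<forall>f\<in>cinf A.
        locop A (\<alpha> + \<beta>) u v = locop A \<alpha> u v + locop A \<beta> u v \<and>
        locop A (\<lambda>p e. f p * \<alpha> p e) u v = fmult f (locop A \<alpha> u v) \<and>
        locop A \<alpha> (u + v) w = locop A \<alpha> u w + locop A \<alpha> v w \<and>
        locop A \<alpha> (fmult f u) v = fmult f (locop A \<alpha> u v) \<and>
        locop A \<alpha> u (v + w) = locop A \<alpha> u v + locop A \<alpha> u w \<and>
        locop A \<alpha> u (fmult f v) = fmult f (locop A \<alpha> u v)) \<and>
     (\<forall>u\<in>gsec A. \<forall>v\<in>gsec A. \<forall>f\<in>cinf A.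
        bracket A (fmult f u) v
          = - fmult (rho A v f) u + fmult f (bracket A u v) + locop A (Dfun A f) u v)"

definition locality_projector ::
  "('m::topological_space, 'a::real_inner, 'v::real_vector, 'z) algebroid_scheme
     \<Rightarrow> (('m \<Rightarrow> 'v) \<Rightarrow> 'm \<Rightarrow> 'v) \<Rightarrow> bool" where
  "locality_projector A P \<longleftrightarrow>
     (\<forall>u\<in>gsec A. P u \<in> gsec A) \<and>
     (\<forall>u\<in>gsec A. \<forall>v\<in>gsec A. P (u + v) = P u + P v) \<and>
     (\<forall>u\<in>gsec A. \<forall>f\<in>cinf A. P (fmult f u) = fmult f (P u)) \<and>
     (\<forall>\<alpha>\<in>one_forms A UNIV. \<forall>u\<in>gsec A. \<forall>v\<in>gsec A. \<forall>p. anchor A p (P (locop A \<alpha> u v) p) = 0) \<and>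
     (\<forall>u\<in>gsec A. (\<forall>p. anchor A p (u p) = 0) \<longrightarrow> P u = u)"

definition linear_connection ::
  "('m::topological_space, 'a::real_inner, 'v::real_vector, 'z) algebroid_scheme
     \<Rightarrow> (('m \<Rightarrow> 'v) \<Rightarrow> ('m \<Rightarrow> 'v) \<Rightarrow> 'm \<Rightarrow> 'v) \<Rightarrow> bool" where
  "linear_connection A nabla \<longleftrightarrow>
     (\<forall>u\<in>gsec A. \<forall>v\<in>gsec A. nabla u v \<in> gsec A) \<and>
     real_bilinear_on (gsec A) nabla \<and>
     (\<forall>u\<in>gsec A. \<forall>v\<in>gsec A. \<forall>f\<in>cinf A.
        nabla u (fmult f v) = fmult (rho A u f) v + fmult f (nabla u v) \<and>
        nabla (fmult f u) v = fmult f (nabla u v))"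

section \<open>Restriction to open sets\<close>

text \<open>
  All operators above are defined on global objects and are local: the value at \<open>p\<close> depends only
  on the germs of the arguments at \<open>p\<close>. Their restriction to an open set \<open>U\<close> is evaluated at
  \<open>p \<in> U\<close> on global objects (members of \<open>S\<close>) with the same germs at \<open>p\<close> as the given local
  ones.
\<close>

definition germ_ext :: "('m::topological_space \<Rightarrow> 'b) set \<Rightarrow> 'm \<Rightarrow> ('m \<Rightarrow> 'b) \<Rightarrow> 'm \<Rightarrow> 'b" where
  "germ_ext S p s = (SOME s'. s' \<in> S \<and> (\<forall>\<^sub>F q in nhds p. s' q = s q))"

abbreviation ext_sec where "ext_sec A p u \<equiv> germ_ext (gsec A) p u"

definition rho_loc ::
  "('m::topological_space, 'a::real_inner, 'v::real_vector, 'z) algebroid_scheme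
     \<Rightarrow> ('m \<Rightarrow> 'v) \<Rightarrow> ('m \<Rightarrow> real) \<Rightarrow> 'm \<Rightarrow> real" where
  "rho_loc A u f = (\<lambda>p. anchor A p (u p) (germ_ext (cinf A) p f))"

definition restr2 ::
  "('m::topological_space, 'a::real_inner, 'v::real_vector, 'z) algebroid_scheme
     \<Rightarrow> (('m \<Rightarrow> 'v) \<Rightarrow> ('m \<Rightarrow> 'v) \<Rightarrow> 'm \<Rightarrow> 'v) \<Rightarrow> ('m \<Rightarrow> 'v) \<Rightarrow> ('m \<Rightarrow> 'v) \<Rightarrow> 'm \<Rightarrow> 'v" where
  "restr2 A F u v = (\<lambda>p. F (ext_sec A p u) (ext_sec A p v) p)"

definition restr3 ::
  "('m::topological_space, 'a::real_inner, 'v::real_vector, 'z) algebroid_scheme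
     \<Rightarrow> (('m \<Rightarrow> 'v) \<Rightarrow> ('m \<Rightarrow> 'v) \<Rightarrow> ('m \<Rightarrow> 'v) \<Rightarrow> 'm \<Rightarrow> 'v)
     \<Rightarrow> ('m \<Rightarrow> 'v) \<Rightarrow> ('m \<Rightarrow> 'v) \<Rightarrow> ('m \<Rightarrow> 'v) \<Rightarrow> 'm \<Rightarrow> 'v" where
  "restr3 A F u v w = (\<lambda>p. F (ext_sec A p u) (ext_sec A p v) (ext_sec A p w) p)"

section \<open>Admissible connections, torsion and curvature\<close>

text \<open>
  The global section \<open>L(e\<^sup>a, \<nabla>\<^bsub>X\<^sub>a\<^esub> u, v)\<close>. A global frame need not exist, so the value at
  \<open>p\<close> is computed in some frame around \<open>p\<close>; it does not depend on that choice.
\<close>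

definition L_contr ::
  "('m::topological_space, 'a::real_inner, 'v::real_vector, 'z) algebroid_scheme
     \<Rightarrow> (('m \<Rightarrow> 'v) \<Rightarrow> ('m \<Rightarrow> 'v) \<Rightarrow> 'm \<Rightarrow> 'v) \<Rightarrow> ('m \<Rightarrow> 'v) \<Rightarrow> ('m \<Rightarrow> 'v) \<Rightarrow> 'm \<Rightarrow> 'v" where
  "L_contr A nabla u v = (\<lambda>p.
     let (U, X, e) = (SOME (U, X, e). p \<in> U \<and> local_frame A U X \<and> dual_coframe A U X e)
     in \<Sum>a<rk A. locop A (germ_ext (one_forms A UNIV) p (e a)) (nabla (ext_sec A p (X a)) u) v p)"

definition admissible ::
  "('m::topological_space, 'a::real_inner, 'v::real_vector, 'z) algebroid_scheme
     \<Rightarrow> (('m \<Rightarrow> 'v) \<Rightarrow> ('m \<Rightarrow> 'v) \<Rightarrow> 'm \<Rightarrow> 'v) \<Rightarrow> bool" where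
  "admissible A nabla \<longleftrightarrow> (\<forall>u\<in>gsec A. \<forall>v\<in>gsec A.
     bracket A u v + bracket A v u = L_contr A nabla u v + L_contr A nabla v u)"

definition mod_bracket ::
  "('m::topological_space, 'a::real_inner, 'v::real_vector, 'z) algebroid_scheme
     \<Rightarrow> (('m \<Rightarrow> 'v) \<Rightarrow> 'm \<Rightarrow> 'v) \<Rightarrow> (('m \<Rightarrow> 'v) \<Rightarrow> ('m \<Rightarrow> 'v) \<Rightarrow> 'm \<Rightarrow> 'v)
     \<Rightarrow> ('m \<Rightarrow> 'v) \<Rightarrow> ('m \<Rightarrow> 'v) \<Rightarrow> 'm \<Rightarrow> 'v" where
  "mod_bracket A P nabla u v = bracket A u v - P (L_contr A nabla u v)"

definition torsion ::
  "('m::topological_space, 'a::real_inner, 'v::real_vector, 'z) algebroid_scheme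
     \<Rightarrow> (('m \<Rightarrow> 'v) \<Rightarrow> 'm \<Rightarrow> 'v) \<Rightarrow> (('m \<Rightarrow> 'v) \<Rightarrow> ('m \<Rightarrow> 'v) \<Rightarrow> 'm \<Rightarrow> 'v)
     \<Rightarrow> ('m \<Rightarrow> 'v) \<Rightarrow> ('m \<Rightarrow> 'v) \<Rightarrow> 'm \<Rightarrow> 'v" where
  "torsion A P nabla u v = nabla u v - nabla v u - mod_bracket A P nabla u v"

definition curvature ::
  "('m::topological_space, 'a::real_inner, 'v::real_vector, 'z) algebroid_scheme
     \<Rightarrow> (('m \<Rightarrow> 'v) \<Rightarrow> 'm \<Rightarrow> 'v) \<Rightarrow> (('m \<Rightarrow> 'v) \<Rightarrow> ('m \<Rightarrow> 'v) \<Rightarrow> 'm \<Rightarrow> 'v)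
     \<Rightarrow> ('m \<Rightarrow> 'v) \<Rightarrow> ('m \<Rightarrow> 'v) \<Rightarrow> ('m \<Rightarrow> 'v) \<Rightarrow> 'm \<Rightarrow> 'v" where
  "curvature A P nabla u v w =
     nabla u (nabla v w) - nabla v (nabla u w) - nabla (mod_bracket A P nabla u v) w"

section \<open>Forms on an open set\<close>

text \<open>
  A \<open>p\<close>-form on \<open>U\<close> is represented by its action on lists of \<open>p\<close> sections over \<open>U\<close>. Only the
  values at points of \<open>U\<close> matter.
\<close>

type_synonym ('m, 'v) form = "('m \<Rightarrow> 'v) list \<Rightarrow> 'm \<Rightarrow> real"

definition forms_eq ::
  "('m::topological_space, 'a::real_inner, 'v::real_vector, 'z) algebroid_scheme \<Rightarrow> 'm set \<Rightarrow> nat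
     \<Rightarrow> ('m, 'v) form \<Rightarrow> ('m, 'v) form \<Rightarrow> bool" where
  "forms_eq A U n \<alpha> \<beta> \<longleftrightarrow>
     (\<forall>vs. length vs = n \<longrightarrow> set vs \<subseteq> sections A U \<longrightarrow> (\<forall>p\<in>U. \<alpha> vs p = \<beta> vs p))"

definition wedge :: "nat \<Rightarrow> nat \<Rightarrow> ('m, 'v) form \<Rightarrow> ('m, 'v) form \<Rightarrow> ('m, 'v) form" where
  "wedge m n \<alpha> \<beta> = (\<lambda>vs p. (1 / (fact m * fact n)) *
     (\<Sum>\<sigma> | \<sigma> permutes {..<m + n}. of_int (sign \<sigma>) *
        \<alpha> (map (\<lambda>i. vs ! \<sigma> i) [0..<m]) p * \<beta> (map (\<lambda>i. vs ! \<sigma> i) [m..<m + n]) p))"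

text \<open>
  The projected exterior derivative. List positions start at 0, so the usual signs
  \<open>(-1)\<^sup>i\<^sup>+\<^sup>1\<close> and \<open>(-1)\<^sup>i\<^sup>+\<^sup>j\<close> (positions from 1) become \<open>(-1)\<^sup>i\<close> and \<open>(-1)\<^sup>i\<^sup>+\<^sup>j\<close>; \<open>nths vs (- I)\<close> omits
  the entries at the positions in \<open>I\<close>.
\<close>

definition ext_deriv ::
  "('m::topological_space, 'a::real_inner, 'v::real_vector, 'z) algebroid_scheme
     \<Rightarrow> (('m \<Rightarrow> 'v) \<Rightarrow> 'm \<Rightarrow> 'v) \<Rightarrow> (('m \<Rightarrow> 'v) \<Rightarrow> ('m \<Rightarrow> 'v) \<Rightarrow> 'm \<Rightarrow> 'v)
     \<Rightarrow> ('m, 'v) form \<Rightarrow> ('m, 'v) form" where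
  "ext_deriv A P nabla \<Omega> = (\<lambda>vs p.
     (\<Sum>i<length vs. (-1) ^ i * rho_loc A (vs ! i) (\<Omega> (nths vs (- {i}))) p) +
     (\<Sum>j<length vs. \<Sum>i<j. (-1) ^ (i + j) *
        \<Omega> (restr2 A (mod_bracket A P nabla) (vs ! i) (vs ! j) # nths vs (- {i, j})) p))"

definition coframe_form :: "(nat \<Rightarrow> 'm \<Rightarrow> 'v \<Rightarrow> real) \<Rightarrow> nat \<Rightarrow> ('m, 'v) form" where
  "coframe_form e a = (\<lambda>vs p. e a p ((vs ! 0) p))"

definition torsion_form ::
  "('m::topological_space, 'a::real_inner, 'v::real_vector, 'z) algebroid_scheme
     \<Rightarrow> (('m \<Rightarrow> 'v) \<Rightarrow> 'm \<Rightarrow> 'v) \<Rightarrow> (('m \<Rightarrow> 'v) \<Rightarrow> ('m \<Rightarrow> 'v) \<Rightarrow> 'm \<Rightarrow> 'v)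
     \<Rightarrow> (nat \<Rightarrow> 'm \<Rightarrow> 'v \<Rightarrow> real) \<Rightarrow> nat \<Rightarrow> ('m, 'v) form" where
  "torsion_form A P nabla e a =
     (\<lambda>vs p. e a p (restr2 A (torsion A P nabla) (vs ! 0) (vs ! 1) p))"

definition curvature_form ::
  "('m::topological_space, 'a::real_inner, 'v::real_vector, 'z) algebroid_scheme
     \<Rightarrow> (('m \<Rightarrow> 'v) \<Rightarrow> 'm \<Rightarrow> 'v) \<Rightarrow> (('m \<Rightarrow> 'v) \<Rightarrow> ('m \<Rightarrow> 'v) \<Rightarrow> 'm \<Rightarrow> 'v)
     \<Rightarrow> (nat \<Rightarrow> 'm \<Rightarrow> 'v) \<Rightarrow> (nat \<Rightarrow> 'm \<Rightarrow> 'v \<Rightarrow> real) \<Rightarrow> nat \<Rightarrow> nat \<Rightarrow> ('m, 'v) form" where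
  "curvature_form A P nabla X e a b =
     (\<lambda>vs p. e a p (restr3 A (curvature A P nabla) (vs ! 0) (vs ! 1) (X b) p))"

definition connection_form ::
  "('m::topological_space, 'a::real_inner, 'v::real_vector, 'z) algebroid_scheme
     \<Rightarrow> (('m \<Rightarrow> 'v) \<Rightarrow> ('m \<Rightarrow> 'v) \<Rightarrow> 'm \<Rightarrow> 'v)
     \<Rightarrow> (nat \<Rightarrow> 'm \<Rightarrow> 'v) \<Rightarrow> (nat \<Rightarrow> 'm \<Rightarrow> 'v \<Rightarrow> real) \<Rightarrow> nat \<Rightarrow> nat \<Rightarrow> ('m, 'v) form" where
  "connection_form A nabla X e a b = (\<lambda>vs p. e a p (restr2 A nabla (vs ! 0) (X b) p))"

end

theory Submission
  imports Defs
begin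

text \<open>
  Every operator is evaluated at a point \<open>p\<close> on global representatives of the germs at \<open>p\<close>, which
  exist by bump functions; the Leibniz rules make this independent of the representatives. On global
  sections, let \<open>[u,v]\<close> be the projected modified bracket. It is anti-symmetric: for admissible
  \<open>\<nabla>\<close> the symmetric part of the original bracket is a contraction of \<open>L\<close>, and it lies in
  \<open>ker \<rho>\<close>, where \<open>P\<close> is the identity. It satisfies the Leibniz rule and is preserved by \<open>\<rho>\<close>, but
  it has no Jacobi identity, and \<open>(d\<^sup>2 \<alpha>)(u,v,w)\<close> is the cyclic sum of \<open>\<alpha>([[u,v],w])\<close>. Since
  \<open>\<nabla>\<close> is a derivation, the left-hand sides are the components of the covariant exterior derivatives
  of torsion and curvature; expanding these, the terms with a double bracket are exactly \<open>d\<^sup>2\<close> of the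
  coframe and of the connection forms, and the other terms are those with the curvature.
\<close>

section \<open>Calculus of \<open>C\<^sup>k\<close> functions\<close>

text \<open>The obstacle is that no operator is defined on local sections directly. Restricted
  operators choose global extensions separately at each point q, so the smoothness of
  \<open>restr2 A F u v\<close> is not visible, and \<open>L_contr\<close> likewise chooses a frame
  point by point. Equal values at p are too weak once operators are nested: iterated \<nabla>,
  double brackets and the outer derivative in d^2 all differentiate an earlier result. Hence
  representatives of u, v, w, X_a, e^a are fixed once; they are valid on a whole neighbourhood of p,
  and locality at each of its points turns equal values into equal germs. The rest is algebra.
  Second derivatives cancel because \<rho> maps the modified bracket to a commutator; this gives
  both the shape of d^2 and the linearity of R(u,v) over functions, which allows R(u,v)s to be
  assembled from the components R^a_b.\<close>

lemma has_derivative_cong_open: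
  assumes "open S" "x \<in> S" "\<And>y. y \<in> S \<Longrightarrow> f y = g y"
  shows "(f has_derivative D) (at x) \<longleftrightarrow> (g has_derivative D) (at x)"
  using has_derivative_transform_within_open[OF _ assms(1,2), of f D UNIV g]
    has_derivative_transform_within_open[OF _ assms(1,2), of g D UNIV f] assms(3) by auto

lemma frechet_derivative_cong_open:
  assumes "open S" "x \<in> S" "\<And>y. y \<in> S \<Longrightarrow> f y = g y"
  shows "frechet_derivative f (at x) = frechet_derivative g (at x)"
  unfolding frechet_derivative_def using has_derivative_cong_open[OF assms] by simp

lemma Ck_on_cong:
  assumes "open S" "\<And>x. x \<in> S \<Longrightarrow> f x = g x"
  shows "Ck_on k S f \<longleftrightarrow> Ck_on k S g"
  using assms(2)
proof (induction k arbitrary: f g)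
  case 0
  then show ?case by (auto intro: continuous_on_cong)
next
  case (Suc k)
  have "f differentiable (at x) \<longleftrightarrow> g differentiable (at x)" if "x \<in> S" for x
    unfolding differentiable_def
    using has_derivative_cong_open[OF assms(1) that Suc.prems] by simp
  moreover have "Ck_on k S (\<lambda>x. frechet_derivative f (at x) v) \<longleftrightarrow>
      Ck_on k S (\<lambda>x. frechet_derivative g (at x) v)" for v
    using frechet_derivative_cong_open[OF assms(1) _ Suc.prems] by (intro Suc.IH) simp
  ultimately show ?case by simp
qed

text \<open>\<open>frechet_derivative\<close> is a chosen object; as a derivative at a point is
  unique, any explicit formula may replace it. The rules for constants, sums, products and
  compositions rest on this.\<close>

lemma Ck_on_SucI:
  assumes "open S" "\<And>x. x \<in> S \<Longrightarrow> (f has_derivative f' x) (at x)"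
    "\<And>v. Ck_on k S (\<lambda>x. f' x v)"
  shows "Ck_on (Suc k) S f"
proof -
  have "Ck_on k S (\<lambda>x. frechet_derivative f (at x) v)" for v
  proof (rule Ck_on_cong[OF assms(1), THEN iffD1, OF _ assms(3)])
    show "f' x v = frechet_derivative f (at x) v" if "x \<in> S" for x
      using frechet_derivative_at[OF assms(2)[OF that]] by simp
  qed
  then show ?thesis
    using assms(2) by (auto simp: differentiable_def)
qed

lemma Ck_on_SucD:
  assumes "Ck_on (Suc k) S f"
  shows "x \<in> S \<Longrightarrow> (f has_derivative frechet_derivative f (at x)) (at x)"
    and "Ck_on k S (\<lambda>x. frechet_derivative f (at x) v)"
  using assms frechet_derivative_works by auto

lemma Ck_on_Suc_imp:
  "Ck_on (Suc k) S f \<Longrightarrow> Ck_on k S f"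
proof (induction k arbitrary: f)
  case 0
  then show ?case
    by (auto intro!: continuous_at_imp_continuous_on differentiable_imp_continuous_within)
next
  case (Suc k)
  then show ?case by simp
qed

lemma Ck_on_local:
  assumes "open S" "\<And>x. x \<in> S \<Longrightarrow> \<exists>T. open T \<and> x \<in> T \<and> Ck_on k T f"
  shows "Ck_on k S f"
  using assms(2)
proof (induction k arbitrary: f)
  case 0
  then show ?case
    by (auto intro!: continuous_at_imp_continuous_on simp: continuous_on_eq_continuous_at)
      (metis continuous_on_eq_continuous_at)
next
  case (Suc k)
  have "Ck_on k S (\<lambda>x. frechet_derivative f (at x) v)" for v
    using Suc.prems by (intro Suc.IH) fastforce
  moreover have "f differentiable (at x)" if "x \<in> S" for x
    using Suc.prems[OF that] by auto
  ultimately show ?case by simp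
qed

lemma Ck_on_subset: "Ck_on k S f \<Longrightarrow> T \<subseteq> S \<Longrightarrow> Ck_on k T f"
  by (induction k arbitrary: f) (auto intro: continuous_on_subset)

lemma Ck_on_const: "open S \<Longrightarrow> Ck_on k S (\<lambda>x. c)"
  by (induction k arbitrary: c) (auto intro!: Ck_on_SucI[where f' = "\<lambda>_ _. 0"] simp del: Ck_on.simps(2))

lemma Ck_on_add:
  assumes "open S" "Ck_on k S f" "Ck_on k S g"
  shows "Ck_on k S (\<lambda>x. f x + g x)"
  using assms(2,3)
proof (induction k arbitrary: f g)
  case 0
  then show ?case by (simp add: continuous_on_add)
next
  case (Suc k)
  show ?case
    using Suc.IH Suc.prems[THEN Ck_on_SucD(2)] Suc.prems[THEN Ck_on_SucD(1)] assms(1)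
    by (intro Ck_on_SucI[where f' = "\<lambda>x v. frechet_derivative f (at x) v + frechet_derivative g (at x) v"]
        has_derivative_add) auto
qed

lemma (in bounded_bilinear) Ck_on:
  assumes "open S" "Ck_on k S f" "Ck_on k S g"
  shows "Ck_on k S (\<lambda>x. prod (f x) (g x))"
  using assms(2,3)
proof (induction k arbitrary: f g)
  case 0
  then show ?case by (simp add: continuous_on)
next
  case (Suc k)
  show ?case
    using Suc.IH Suc.prems[THEN Ck_on_SucD(2)] Suc.prems[THEN Ck_on_SucD(1)]
      Suc.prems[THEN Ck_on_Suc_imp] assms(1)
    by (intro Ck_on_SucI[where f' = "\<lambda>x v. prod (f x) (frechet_derivative g (at x) v)
          + prod (frechet_derivative f (at x) v) (g x)"] FDERIV Ck_on_add) auto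
qed

lemma Ck_on_compose_real:
  fixes g :: "real \<Rightarrow> real" and f :: "'a::real_normed_vector \<Rightarrow> real"
  assumes "open S" "Ck_on k UNIV g" "Ck_on k S f"
  shows "Ck_on k S (\<lambda>x. g (f x))"
  using assms(2,3)
proof (induction k arbitrary: f g)
  case 0
  then show ?case
    by (auto intro: continuous_on_compose2)
next
  case (Suc k)
  \<comment> \<open>A linear map on the reals is multiplication by its value at 1, so the chain rule
    yields a product of real functions, to which the bilinear rule applies.\<close>
  let ?g' = "\<lambda>y. frechet_derivative g (at y) 1"
  have g': "(g has_derivative (\<lambda>h. ?g' y * h)) (at y)" for y
  proof -
    have "linear (frechet_derivative g (at y))"
      using Ck_on_SucD(1)[OF Suc.prems(1)] has_derivative_linear by blast
    then have "frechet_derivative g (at y) = (\<lambda>h. ?g' y * h)"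
      by (metis linear_cmul mult.commute mult.right_neutral real_scaleR_def)
    then show ?thesis
      using Ck_on_SucD(1)[OF Suc.prems(1), of y] by simp
  qed
  show ?case
  proof (rule Ck_on_SucI[OF assms(1)])
    show "((\<lambda>x. g (f x)) has_derivative (\<lambda>v. ?g' (f x) * frechet_derivative f (at x) v)) (at x)"
      if "x \<in> S" for x
      using has_derivative_compose[OF Ck_on_SucD(1)[OF Suc.prems(2) that] g'] by simp
    show "Ck_on k S (\<lambda>x. ?g' (f x) * frechet_derivative f (at x) v)" for v
      by (rule bounded_bilinear.Ck_on[OF bounded_bilinear_mult assms(1)
            Suc.IH[OF Ck_on_SucD(2)[OF Suc.prems(1)] Ck_on_Suc_imp[OF Suc.prems(2)]]
            Ck_on_SucD(2)[OF Suc.prems(2)]])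
  qed
qed

section \<open>Bump functions\<close>

text \<open>The classical flat function e^(-1/x) is the case n = 0. The factors x^(-n) make the
  family closed under differentiation up to linear combinations, so smoothness follows by induction
  on k with n arbitrary.\<close>

definition flat :: "nat \<Rightarrow> real \<Rightarrow> real" where
  "flat n x = (if x > 0 then inverse x ^ n / exp (inverse x) else 0)"

lemma flat_tendsto_0: "(flat n \<longlongrightarrow> 0) (at 0)"
proof -
  have "((\<lambda>x::real. inverse x ^ n / exp (inverse x)) \<longlongrightarrow> 0) (at_right 0)"
    by (rule filterlim_compose[OF tendsto_power_div_exp_0 filterlim_inverse_at_top_right])
  then have "(flat n \<longlongrightarrow> 0) (at_right 0)"
    by (rule tendsto_cong[THEN iffD2, rotated])
      (simp add: eventually_at_filter flat_def)
  moreover have "(flat n \<longlongrightarrow> 0) (at_left 0)"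
    by (rule tendsto_eventually) (simp add: eventually_at_filter flat_def)
  ultimately show ?thesis
    using filterlim_split_at by blast
qed

lemma flat_has_derivative:
  "(flat n has_real_derivative (flat (n + 2) x - real n * flat (n + 1) x)) (at x)"
proof -
  consider "x > 0" | "x < 0" | "x = 0" by linarith
  then show ?thesis
  proof cases
    case 1
    \<comment> \<open>Differentiation is done in y = 1/x. For n = 0 the truncated exponent
      \<open>n - 1\<close> is harmless, since its factor n is 0.\<close>
    have "((\<lambda>y. y ^ n / exp y) has_real_derivative (real n * y ^ (n - 1) - y ^ n) / exp y) (at y)"
      for y :: real
      by (auto intro!: derivative_eq_intros simp: divide_simps) (simp add: algebra_simps)
    from DERIV_chain2[OF this DERIV_inverse, of x]
    have "((\<lambda>x. inverse x ^ n / exp (inverse x)) has_real_derivative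
        (real n * inverse x ^ (n - 1) - inverse x ^ n) / exp (inverse x) * - (inverse x)\<^sup>2) (at x)"
      using 1 by (simp add: numeral_2_eq_2)
    moreover have "(real n * inverse x ^ (n - 1) - inverse x ^ n) / exp (inverse x) * - (inverse x)\<^sup>2
        = flat (n + 2) x - real n * flat (n + 1) x"
      using 1 by (cases n) (simp_all add: flat_def power2_eq_square diff_divide_distrib add_divide_distrib algebra_simps)
    ultimately have "((\<lambda>x. inverse x ^ n / exp (inverse x)) has_real_derivative
        (flat (n + 2) x - real n * flat (n + 1) x)) (at x)"
      by simp
    then show ?thesis
      using 1 by (elim has_field_derivative_transform_within_open[where S = "{0<..}"]) (auto simp: flat_def)
  next
    case 2
    have "((\<lambda>x. 0) has_real_derivative (flat (n + 2) x - real n * flat (n + 1) x)) (at x)"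
      using 2 by (simp add: flat_def)
    then show ?thesis
      using 2 by (elim has_field_derivative_transform_within_open[where S = "{..<0}"]) (auto simp: flat_def)
  next
    case 3
    \<comment> \<open>At 0 the difference quotient is the next member of the family, which tends to
      0; the claimed derivative is 0 there as well.\<close>
    have "(flat n y - flat n 0) / (y - 0) = flat (n + 1) y" if "y \<noteq> 0" for y
      using that by (auto simp: flat_def field_simps)
    then have "((\<lambda>y. (flat n y - flat n 0) / (y - 0)) \<longlongrightarrow> 0) (at 0)"
      by (intro tendsto_cong[THEN iffD2, OF _ flat_tendsto_0[of "n + 1"]])
        (simp add: eventually_at_filter)
    then show ?thesis
      using 3 by (simp add: has_field_derivative_iff flat_def)
  qed
qed

lemma Ck_on_flat: "Ck_on k UNIV (flat n)"
proof (induction k arbitrary: n)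
  case 0
  then show ?case
    by (auto intro!: continuous_at_imp_continuous_on DERIV_isCont[OF flat_has_derivative])
next
  case (Suc k)
  show ?case
  proof (rule Ck_on_SucI[OF open_UNIV])
    show "(flat n has_derivative (\<lambda>v. (flat (n + 2) x + (- real n) * flat (n + 1) x) * v)) (at x)" for x
      using flat_has_derivative[of n x] by (simp add: has_field_derivative_def)
    show "Ck_on k UNIV (\<lambda>x. (flat (n + 2) x + (- real n) * flat (n + 1) x) * v)" for v
      by (intro bounded_bilinear.Ck_on[OF bounded_bilinear_mult] Ck_on_add Ck_on_const Suc.IH open_UNIV)
  qed
qed

lemma smooth_step:
  obtains g :: "real \<Rightarrow> real"
  where "\<And>k. Ck_on k UNIV g" "\<And>t. t \<le> 0 \<Longrightarrow> g t = 1" "\<And>t. t \<ge> 1 \<Longrightarrow> g t = 0"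
proof
  \<comment> \<open>Since \<open>flat 0 1\<close> is exp (-1), the factor e normalizes it to 1. For
    t \<le> 0 the outer \<open>flat 0\<close> is taken at 1; for t \<ge> 1 the product e * exp
    (-1/t) is at least 1, so the outer argument is at most 0.\<close>
  let ?c = "exp 1 :: real"
  let ?g = "\<lambda>t. ?c * flat 0 (1 + (- ?c) * flat 0 t)"
  show "Ck_on k UNIV ?g" for k
    by (intro bounded_bilinear.Ck_on[OF bounded_bilinear_mult] Ck_on_const open_UNIV
        Ck_on_compose_real[OF _ Ck_on_flat] Ck_on_add Ck_on_flat)
  show "?g t = 1" if "t \<le> 0" for t
    using that by (simp add: flat_def)
  show "?g t = 0" if "t \<ge> 1" for t
  proof -
    have "inverse t \<le> 1"
      using that by (simp add: field_simps)
    then show ?thesis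
      using that by (simp add: flat_def field_simps)
  qed
qed

text \<open>The model space is only an inner product space with a finite spanning set. Over an
  orthogonal spanning set, Cauchy-Schwarz bounds the coefficients of a vector of norm at most r;
  vectors with such coefficients form a finite sum of segments, which is compact, and the ball is
  closed in it.\<close>

lemma compact_cball_of_finite_span:
  fixes x :: "'a::real_inner"
  assumes "finite B" "span B = (UNIV :: 'a set)"
  shows "compact (cball x r)"
proof -
  obtain C where C: "finite C" "span C = (UNIV :: 'a set)" "pairwise orthogonal C"
    using basis_orthogonal[OF assms(1)] assms(2) by auto
  define K where "K D = (\<lambda>c. \<Sum>b\<in>D. c b *\<^sub>R b) ` {c. \<forall>b\<in>D. \<bar>c b\<bar> \<le> r / norm b}" for D :: "'a set"
  have K: "compact (K D)" if "finite D" for D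
    using that
  proof induction
    case empty
    have "K {} \<subseteq> {0}" by (auto simp: K_def)
    then show ?case using finite_subset finite_imp_compact by blast
  next
    case (insert b D)
    have eq: "K (insert b D) = {x + y |x y. x \<in> (\<lambda>t. t *\<^sub>R b) ` {- (r / norm b)..r / norm b} \<and> y \<in> K D}"
      (is "_ = ?R")
    proof (intro equalityI subsetI)
      fix z assume "z \<in> K (insert b D)"
      then show "z \<in> ?R"
        using insert.hyps by (force simp: K_def abs_le_iff)
    next
      fix z assume "z \<in> ?R"
      then obtain t c where tc: "- (r / norm b) \<le> t" "t \<le> r / norm b"
        "\<forall>b\<in>D. \<bar>c b\<bar> \<le> r / norm b" and z: "z = t *\<^sub>R b + (\<Sum>b\<in>D. c b *\<^sub>R b)"
        by (auto simp: K_def)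
      have "(\<Sum>b'\<in>D. (c(b := t)) b' *\<^sub>R b') = (\<Sum>b\<in>D. c b *\<^sub>R b)"
        using insert.hyps by (intro sum.cong) auto
      then have "z = (\<Sum>b'\<in>insert b D. (c(b := t)) b' *\<^sub>R b')"
        using z insert.hyps by simp
      then show "z \<in> K (insert b D)"
        unfolding K_def using tc insert.hyps
        by (intro image_eqI[where x = "c(b := t)"]) (auto simp: abs_le_iff)
    qed
    have "compact ((\<lambda>t. t *\<^sub>R b) ` {- (r / norm b)..r / norm b})"
      by (intro compact_continuous_image continuous_intros compact_Icc)
    then show ?case
      unfolding eq using insert.IH by (rule compact_sums)
  qed
  have "cball 0 r \<subseteq> K C"
  proof
    fix y assume y: "(y::'a) \<in> cball 0 r"
    have "y \<in> span C" using C(2) by simp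
    then obtain c where c: "y = (\<Sum>b\<in>C. c b *\<^sub>R b)"
      using span_finite[OF C(1)] by auto
    have "\<bar>c b\<bar> \<le> r / norm b" if "b \<in> C" "b \<noteq> 0" for b
    proof -
      have "inner y b = (\<Sum>b'\<in>C. if b' = b then c b * inner b b else 0)"
        unfolding c inner_sum_left using C(3) that
        by (intro sum.cong) (auto simp: pairwise_def orthogonal_def)
      then have "inner y b = c b * (norm b)\<^sup>2"
        using C(1) that by (simp add: power2_norm_eq_inner)
      then have "\<bar>c b\<bar> * (norm b)\<^sup>2 \<le> norm y * norm b"
        using Cauchy_Schwarz_ineq2[of y b] by (simp add: abs_mult)
      then have "\<bar>c b\<bar> * norm b \<le> norm y"
        using that by (simp add: power2_eq_square)
      then show ?thesis
        using that y by (simp add: field_simps)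
    qed
    \<comment> \<open>An orthogonal set may contain 0, where the bound \<open>r / norm b\<close> is
      0 by convention. Resetting that coefficient meets the bound without changing the sum.\<close>
    moreover have "y = (\<Sum>b\<in>C. (c(0 := 0)) b *\<^sub>R b)"
      unfolding c by (intro sum.cong) auto
    ultimately show "y \<in> K C"
      unfolding K_def by (intro image_eqI[where x = "c(0 := 0)"]) auto
  qed
  then have "compact (cball 0 r :: 'a set)"
    using compact_Int_closed[OF K[OF C(1)] closed_cball[of 0 r]] by (simp add: Int_absorb1)
  then show ?thesis
    using compact_translation[of "cball 0 r" x] by simp
qed

section \<open>Smooth functions on a manifold\<close>

lemma smooth_funs_iff:
  "f \<in> smooth_funs \<A> W \<longleftrightarrow> (\<forall>(U, \<phi>)\<in>\<A>. \<forall>k. Ck_on k (\<phi> ` (U \<inter> W)) (\<lambda>x. f (inv_into U \<phi> x)))"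
  by (simp add: smooth_funs_def smooth_on_def comp_def)

lemma chart_facts:
  assumes "smooth_manifold \<A>" "(U, \<phi>) \<in> \<A>"
  shows chart_open: "open U"
    and chart_inj: "inj_on \<phi> U"
    and chart_continuous: "continuous_on U \<phi>"
    and chart_inv_continuous: "continuous_on (\<phi> ` U) (inv_into U \<phi>)"
    and chart_image_open: "open W \<Longrightarrow> open (\<phi> ` (U \<inter> W))"
proof -
  obtain \<psi> where o: "open U" "open (\<phi> ` U)" and h: "homeomorphism U (\<phi> ` U) \<phi> \<psi>"
    using assms unfolding smooth_manifold_def by fastforce
  have \<psi>: "\<psi> (\<phi> q) = q" if "q \<in> U" for q
    using h that by (simp add: homeomorphism_def)
  show "open U" by fact
  show inj: "inj_on \<phi> U"
    by (metis \<psi> inj_onI)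
  show "continuous_on U \<phi>"
    using h by (simp add: homeomorphism_def)
  have "continuous_on (\<phi> ` U) \<psi>"
    using h by (simp add: homeomorphism_def)
  then show "continuous_on (\<phi> ` U) (inv_into U \<phi>)"
    by (rule continuous_on_eq) (auto simp: \<psi> inj)
  assume "open W"
  then have "openin (top_of_set (\<phi> ` U)) (\<phi> ` (U \<inter> W))"
    by (intro homeomorphism_imp_open_map[OF h]) (simp add: openin_open_Int)
  then show "open (\<phi> ` (U \<inter> W))"
    using o(2) openin_open_trans by blast
qed

lemma smooth_funs_localI:
  assumes "smooth_manifold \<A>" "open W"
    and "\<And>p. p \<in> W \<Longrightarrow> \<exists>N g. open N \<and> p \<in> N \<and> g \<in> smooth_funs \<A> N \<and> (\<forall>q\<in>N. f q = g q)"
  shows "f \<in> smooth_funs \<A> W"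
  unfolding smooth_funs_iff
proof (safe)
  fix U \<phi> k assume c: "(U, \<phi>) \<in> \<A>"
  show "Ck_on k (\<phi> ` (U \<inter> W)) (\<lambda>x. f (inv_into U \<phi> x))"
  proof (rule Ck_on_local)
    show "open (\<phi> ` (U \<inter> W))" by (rule chart_image_open[OF assms(1) c assms(2)])
    fix x assume "x \<in> \<phi> ` (U \<inter> W)"
    then obtain p where p: "p \<in> U" "p \<in> W" "x = \<phi> p" by auto
    then obtain N g where N: "open N" "p \<in> N" "g \<in> smooth_funs \<A> N" "\<forall>q\<in>N. f q = g q"
      using assms(3) by blast
    have g: "Ck_on k (\<phi> ` (U \<inter> N)) (\<lambda>x. g (inv_into U \<phi> x))"
      using N(3) c by (auto simp: smooth_funs_iff)
    have o: "open (\<phi> ` (U \<inter> N))" by (rule chart_image_open[OF assms(1) c N(1)])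
    have eq: "f (inv_into U \<phi> y) = g (inv_into U \<phi> y)" if "y \<in> \<phi> ` (U \<inter> N)" for y
      using that N(4) chart_inj[OF assms(1) c] by auto
    have "Ck_on k (\<phi> ` (U \<inter> N)) (\<lambda>x. f (inv_into U \<phi> x))"
      using g Ck_on_cong[OF o eq] by simp
    then show "\<exists>T. open T \<and> x \<in> T \<and> Ck_on k T (\<lambda>x. f (inv_into U \<phi> x))"
      using o p N(2) by blast
  qed
qed

lemma smooth_funs_mono: "f \<in> smooth_funs \<A> W \<Longrightarrow> V \<subseteq> W \<Longrightarrow> f \<in> smooth_funs \<A> V"
  unfolding smooth_funs_iff by (force intro: Ck_on_subset[OF _ image_mono])

lemma smooth_funs_cong:
  assumes "smooth_manifold \<A>" "open W" "g \<in> smooth_funs \<A> W" "\<And>q. q \<in> W \<Longrightarrow> f q = g q"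
  shows "f \<in> smooth_funs \<A> W"
  using assms by (intro smooth_funs_localI[OF assms(1,2)]) blast

lemma smooth_funs_const: "smooth_manifold \<A> \<Longrightarrow> open W \<Longrightarrow> (\<lambda>q. c) \<in> smooth_funs \<A> W"
  by (auto simp: smooth_funs_iff intro!: Ck_on_const chart_image_open)

lemma smooth_funs_add:
  "smooth_manifold \<A> \<Longrightarrow> open W \<Longrightarrow> f \<in> smooth_funs \<A> W \<Longrightarrow> g \<in> smooth_funs \<A> W
    \<Longrightarrow> (\<lambda>q. f q + g q) \<in> smooth_funs \<A> W"
  by (auto simp: smooth_funs_iff intro!: Ck_on_add chart_image_open)

lemma smooth_funs_mult:
  "smooth_manifold \<A> \<Longrightarrow> open W \<Longrightarrow> f \<in> smooth_funs \<A> W \<Longrightarrow> g \<in> smooth_funs \<A> W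
    \<Longrightarrow> (\<lambda>q. f q * g q) \<in> smooth_funs \<A> W"
  by (auto simp: smooth_funs_iff intro!: bounded_bilinear.Ck_on[OF bounded_bilinear_mult] chart_image_open)

lemma smooth_funs_diff:
  assumes "smooth_manifold \<A>" "open W" "f \<in> smooth_funs \<A> W" "g \<in> smooth_funs \<A> W"
  shows "(\<lambda>q. f q - g q) \<in> smooth_funs \<A> W"
  using smooth_funs_add[OF assms(1-3) smooth_funs_mult[OF assms(1,2) smooth_funs_const[OF assms(1,2), of "-1"] assms(4)]]
  by simp

text \<open>Extension by zero beyond a chart is smooth only if the support is closed in M, not
  merely in the chart. It lies in the image C of a compact ball, and compact sets are closed in the
  Hausdorff space M; so the chart domain and the complement of C are an open cover.\<close>

lemma smooth_bump:
  fixes \<A> :: "('m::{t2_space,second_countable_topology}, 'a::real_inner) chart set"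
  assumes sm: "smooth_manifold \<A>" and "open W" "p \<in> W"
  obtains b C where "b \<in> smooth_funs \<A> UNIV" "closed C" "C \<subseteq> W"
    "\<And>q. q \<notin> C \<Longrightarrow> b q = 0" "\<forall>\<^sub>F q in nhds p. b q = (1::real)"
proof -
  have "p \<in> (\<Union>(U, \<phi>)\<in>\<A>. U)"
    using sm by (simp add: smooth_manifold_def)
  then obtain U \<phi> where c: "(U, \<phi>) \<in> \<A>" "p \<in> U"
    by blast
  note inj = chart_inj[OF sm c(1)]
  have "open (\<phi> ` (U \<inter> W))" "\<phi> p \<in> \<phi> ` (U \<inter> W)"
    using chart_image_open[OF sm c(1) \<open>open W\<close>] c assms by auto
  then obtain r where r: "r > 0" "cball (\<phi> p) r \<subseteq> \<phi> ` (U \<inter> W)"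
    using open_contains_cball by blast
  obtain g where g: "\<And>k. Ck_on k UNIV g" "\<And>t. t \<le> 0 \<Longrightarrow> g t = (1::real)" "\<And>t::real. t \<ge> 1 \<Longrightarrow> g t = 0"
    using smooth_step by blast
  \<comment> \<open>With d the distance to \<phi> p, this is 2 d^2 / r^2 - 1: at most 0 for d \<le>
    r / 2 and at least 1 for d \<ge> r, matching the thresholds of the step g.\<close>
  define h where "h y = 2 / r\<^sup>2 * inner (y + - \<phi> p) (y + - \<phi> p) + -1" for y
  define b where "b q = (if q \<in> U then g (h (\<phi> q)) else 0)" for q
  define C where "C = inv_into U \<phi> ` cball (\<phi> p) r"
  obtain B :: "'a set" where "finite B" "span B = UNIV"
    using sm by (auto simp: smooth_manifold_def)
  then have "compact (cball (\<phi> p) r)"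
    by (rule compact_cball_of_finite_span)
  moreover have "continuous_on (cball (\<phi> p) r) (inv_into U \<phi>)"
    using chart_inv_continuous[OF sm c(1)] r(2) continuous_on_subset by blast
  ultimately have C: "closed C"
    unfolding C_def using compact_continuous_image compact_imp_closed by blast
  have CUW: "C \<subseteq> U \<inter> W"
    unfolding C_def using r(2) inj by force
  have b0: "b q = 0" if "q \<notin> C" for q
  proof (cases "q \<in> U")
    case True
    then have "\<phi> q \<notin> cball (\<phi> p) r"
      using that inj unfolding C_def by (metis image_eqI inv_into_f_f)
    then have "r < norm (\<phi> q - \<phi> p)"
      by (simp add: dist_norm norm_minus_commute)
    then have "r\<^sup>2 \<le> (norm (\<phi> q - \<phi> p))\<^sup>2"
      using r(1) by (intro power_mono) auto
    then have "h (\<phi> q) \<ge> 1"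
      using r(1) by (simp add: h_def field_simps power2_norm_eq_inner)
    then show ?thesis
      using g(3) by (simp add: b_def)
  qed (simp add: b_def)
  have "open (U \<inter> \<phi> -` ball (\<phi> p) (r / 2))"
    using chart_continuous[OF sm c(1)] chart_open[OF sm c(1)]
    by (simp add: continuous_on_open_vimage Int_commute)
  moreover have "b q = 1" if "q \<in> U \<inter> \<phi> -` ball (\<phi> p) (r / 2)" for q
  proof -
    have "norm (\<phi> q - \<phi> p) \<le> r / 2"
      using that by (simp add: dist_norm norm_minus_commute)
    then have "(norm (\<phi> q - \<phi> p))\<^sup>2 \<le> (r / 2)\<^sup>2"
      by (intro power_mono) auto
    moreover have "2 * (r / 2)\<^sup>2 \<le> r\<^sup>2"
      by (simp add: power_divide)
    ultimately have "2 * (norm (\<phi> q - \<phi> p))\<^sup>2 \<le> r\<^sup>2"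
      by linarith
    then have "h (\<phi> q) \<le> 0"
      using r(1) by (simp add: h_def field_simps power2_norm_eq_inner)
    then show ?thesis
      using g(2) that by (simp add: b_def)
  qed
  ultimately have b1: "\<forall>\<^sub>F q in nhds p. b q = 1"
    using c(2) r(1) unfolding eventually_nhds
    by (intro exI[of _ "U \<inter> \<phi> -` ball (\<phi> p) (r / 2)"]) auto
  have on_U: "(\<lambda>q. g (h (\<phi> q))) \<in> smooth_funs \<A> U"
    unfolding smooth_funs_iff
  proof safe
    fix V \<psi> k assume d: "(V, \<psi>) \<in> \<A>"
    have o: "open (\<psi> ` (V \<inter> U))"
      using chart_image_open[OF sm d] chart_open[OF sm c(1)] by blast
    have "\<forall>(V, \<psi>)\<in>\<A>. \<forall>(U, \<phi>)\<in>\<A>. smooth_on (\<psi> ` (V \<inter> U)) (\<phi> \<circ> inv_into V \<psi>)"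
      using sm by (simp add: smooth_manifold_def)
    from bspec[OF bspec[OF this d, unfolded prod.case] c(1)]
    have "Ck_on k (\<psi> ` (V \<inter> U)) (\<lambda>x. \<phi> (inv_into V \<psi> x))"
      by (simp add: smooth_on_def comp_def)
    then show "Ck_on k (\<psi> ` (V \<inter> U)) (\<lambda>x. g (h (\<phi> (inv_into V \<psi> x))))"
      unfolding h_def
      by (intro Ck_on_compose_real[OF o g(1)] Ck_on_add[OF o] Ck_on_const[OF o]
          bounded_bilinear.Ck_on[OF bounded_bilinear_mult o]
          bounded_bilinear.Ck_on[OF bounded_bilinear_inner o])
  qed
  have "b \<in> smooth_funs \<A> UNIV"
  proof (rule smooth_funs_localI[OF sm open_UNIV])
    fix q
    show "\<exists>N g. open N \<and> q \<in> N \<and> g \<in> smooth_funs \<A> N \<and> (\<forall>q\<in>N. b q = g q)"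
    proof (cases "q \<in> U")
      case True
      then show ?thesis
        using on_U chart_open[OF sm c(1)] by (intro exI[of _ U] exI) (auto simp: b_def)
    next
      case False
      then show ?thesis
        using b0 C CUW smooth_funs_const[OF sm, of "- C" 0]
        by (intro exI[of _ "- C"] exI[of _ "\<lambda>_. 0"]) (auto simp: open_Compl)
    qed
  qed
  then show ?thesis
    using that[of b C] C CUW b0 b1 by auto
qed

section \<open>Sections and one-forms\<close>

lemma vector_bundle_smooth_manifold: "vector_bundle E \<Longrightarrow> smooth_manifold (atlas E)"
  by (simp add: vector_bundle_def)

lemma vector_bundle_subspace: "vector_bundle E \<Longrightarrow> subspace (fibre E p)"
  by (simp add: vector_bundle_def)

lemma triv_facts:
  assumes "vector_bundle E" "(U, \<Phi>) \<in> trivs E"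
  shows triv_open: "open U"
    and triv_linear: "p \<in> U \<Longrightarrow> i < rk E \<Longrightarrow> linear_over (fibre E p) (\<lambda>e. \<Phi> p e i)"
    and triv_bij: "p \<in> U \<Longrightarrow>
      bij_betw (\<lambda>e. restrict (\<Phi> p e) {..<rk E}) (fibre E p) ({..<rk E} \<rightarrow>\<^sub>E UNIV)"
  using assms by (fastforce simp: vector_bundle_def)+

lemma linear_over_0: "linear_over F l \<Longrightarrow> subspace F \<Longrightarrow> l 0 = 0"
  using subspace_0 unfolding linear_over_def by (metis mult_zero_left scale_zero_left)

lemma linear_over_sum:
  assumes "linear_over F l" "subspace F" "\<And>i. i \<in> I \<Longrightarrow> x i \<in> F"
  shows "l (\<Sum>i\<in>I. c i *\<^sub>R x i) = (\<Sum>i\<in>I. c i * l (x i))"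
  using assms(3)
proof (induction I rule: infinite_finite_induct)
  case (insert i I)
  have "(\<Sum>i\<in>I. c i *\<^sub>R x i) \<in> F"
    using insert.prems assms(2) by (intro subspace_sum subspace_scale) auto
  then show ?case
    using insert assms(1,2) by (simp add: linear_over_def subspace_scale)
qed (simp_all add: linear_over_0[OF assms(1,2)])

lemma sections_fibre: "u \<in> sections E W \<Longrightarrow> p \<in> W \<Longrightarrow> u p \<in> fibre E p"
  by (simp add: sections_def)

lemma sections_coord:
  "u \<in> sections E W \<Longrightarrow> (V, \<Phi>) \<in> trivs E \<Longrightarrow> i < rk E
    \<Longrightarrow> (\<lambda>p. \<Phi> p (u p) i) \<in> smooth_funs (atlas E) (V \<inter> W)"
  by (auto simp: sections_def)

lemma sections_localI:
  assumes vb: "vector_bundle E" and "open W"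
    and loc: "\<And>p. p \<in> W \<Longrightarrow> \<exists>N v. open N \<and> p \<in> N \<and> v \<in> sections E N \<and> (\<forall>q\<in>N. u q = v q)"
  shows "u \<in> sections E W"
  unfolding sections_def
proof (safe)
  show "u p \<in> fibre E p" if "p \<in> W" for p
    using loc[OF that] by (auto simp: sections_fibre)
  fix V \<Phi> i assume V: "(V, \<Phi>) \<in> trivs E" and i: "i < rk E"
  show "(\<lambda>p. \<Phi> p (u p) i) \<in> smooth_funs (atlas E) (V \<inter> W)"
  proof (rule smooth_funs_localI[OF vector_bundle_smooth_manifold[OF vb]])
    show "open (V \<inter> W)" using triv_open[OF vb V] \<open>open W\<close> by blast
    fix p assume p: "p \<in> V \<inter> W"
    then obtain N v where N: "open N" "p \<in> N" "v \<in> sections E N" "\<forall>q\<in>N. u q = v q"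
      using loc by blast
    then show "\<exists>N g. open N \<and> p \<in> N \<and> g \<in> smooth_funs (atlas E) N \<and> (\<forall>q\<in>N. \<Phi> q (u q) i = g q)"
      using sections_coord[OF N(3) V i] triv_open[OF vb V] p
      by (intro exI[of _ "V \<inter> N"] exI[of _ "\<lambda>p. \<Phi> p (v p) i"]) auto
  qed
qed

lemma sections_mono: "u \<in> sections E W \<Longrightarrow> V \<subseteq> W \<Longrightarrow> u \<in> sections E V"
  unfolding sections_def by (force intro: smooth_funs_mono)

context
  fixes E :: "('m::{t2_space,second_countable_topology}, 'a::real_inner, 'v::real_vector, 'z) vbundle_scheme"
    and W :: "'m set"
  assumes vb: "vector_bundle E" and W: "open W"
begin

private lemmas sm = vector_bundle_smooth_manifold[OF vb]
private lemmas sub = vector_bundle_subspace[OF vb]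

lemma sections_zero: "0 \<in> sections E W"
proof -
  have "(\<lambda>p. \<Phi> p 0 i) \<in> smooth_funs (atlas E) (V \<inter> W)"
    if V: "(V, \<Phi>) \<in> trivs E" and i: "i < rk E" for V \<Phi> i
    using triv_open[OF vb V] W linear_over_0[OF triv_linear[OF vb V _ i] sub]
    by (intro smooth_funs_cong[OF sm _ smooth_funs_const[OF sm, of _ 0]]) auto
  then show ?thesis
    by (auto simp: sections_def subspace_0[OF sub])
qed

lemma sections_add:
  assumes "u \<in> sections E W" "v \<in> sections E W"
  shows "u + v \<in> sections E W"
proof -
  have "(\<lambda>p. \<Phi> p (u p + v p) i) \<in> smooth_funs (atlas E) (V \<inter> W)"
    if V: "(V, \<Phi>) \<in> trivs E" and i: "i < rk E" for V \<Phi> i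
  proof (rule smooth_funs_cong[OF sm])
    show o: "open (V \<inter> W)" using triv_open[OF vb V] W by blast
    show "(\<lambda>p. \<Phi> p (u p) i + \<Phi> p (v p) i) \<in> smooth_funs (atlas E) (V \<inter> W)"
      by (intro smooth_funs_add[OF sm o] sections_coord assms V i)
    show "\<Phi> q (u q + v q) i = \<Phi> q (u q) i + \<Phi> q (v q) i" if "q \<in> V \<inter> W" for q
      using triv_linear[OF vb V _ i, of q] that assms[THEN sections_fibre, of q]
      by (simp add: linear_over_def)
  qed
  then show ?thesis
    using assms[THEN sections_fibre] by (auto simp: sections_def subspace_add[OF sub])
qed

lemma sections_fmult:
  assumes "u \<in> sections E W" "f \<in> smooth_funs (atlas E) W"
  shows "fmult f u \<in> sections E W"
proof -
  have "(\<lambda>p. \<Phi> p (f p *\<^sub>R u p) i) \<in> smooth_funs (atlas E) (V \<inter> W)"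
    if V: "(V, \<Phi>) \<in> trivs E" and i: "i < rk E" for V \<Phi> i
  proof (rule smooth_funs_cong[OF sm])
    show o: "open (V \<inter> W)" using triv_open[OF vb V] W by blast
    show "(\<lambda>p. f p * \<Phi> p (u p) i) \<in> smooth_funs (atlas E) (V \<inter> W)"
      by (intro smooth_funs_mult[OF sm o] sections_coord assms V i smooth_funs_mono[OF assms(2)]) auto
    show "\<Phi> q (f q *\<^sub>R u q) i = f q * \<Phi> q (u q) i" if "q \<in> V \<inter> W" for q
      using triv_linear[OF vb V _ i, of q] that assms(1)[THEN sections_fibre, of q]
      by (simp add: linear_over_def)
  qed
  then show ?thesis
    using assms(1)[THEN sections_fibre] by (auto simp: sections_def fmult_def subspace_scale[OF sub])
qed

lemma sections_uminus: "u \<in> sections E W \<Longrightarrow> - u \<in> sections E W"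
  using sections_fmult[of u "\<lambda>_. -1"] smooth_funs_const[OF sm W] by (simp add: fmult_def fun_Compl_def)

lemma sections_diff: "u \<in> sections E W \<Longrightarrow> v \<in> sections E W \<Longrightarrow> u - v \<in> sections E W"
  using sections_add[OF _ sections_uminus] by (metis diff_conv_add_uminus)

lemma sections_sum: "(\<And>i. i \<in> I \<Longrightarrow> u i \<in> sections E W) \<Longrightarrow> (\<Sum>i\<in>I. u i) \<in> sections E W"
  by (induction I rule: infinite_finite_induct) (simp_all add: sections_zero sections_add)

end

context
  fixes E :: "('m::{t2_space,second_countable_topology}, 'a::real_inner, 'v::real_vector, 'z) vbundle_scheme"
    and W :: "'m set"
  assumes vb: "vector_bundle E" and W: "open W"
begin

private lemmas smooth = vector_bundle_smooth_manifold[OF vb]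

text \<open>Values of u outside W are arbitrary and need not lie in the fibre. A bump function
  supported in a closed C inside W makes the product zero on the open complement of C, which
  together with W covers M.\<close>

lemma sections_ext:
  assumes "p \<in> W" "u \<in> sections E W"
  shows "\<exists>u'. u' \<in> sections E UNIV \<and> (\<forall>\<^sub>F q in nhds p. u' q = u q)"
proof -
  obtain b C where b: "b \<in> smooth_funs (atlas E) UNIV" "closed C" "C \<subseteq> W"
    "\<And>q. q \<notin> C \<Longrightarrow> b q = 0" "\<forall>\<^sub>F q in nhds p. b q = (1::real)"
    using smooth_bump[OF smooth W assms(1)] by blast
  have "fmult b u \<in> sections E UNIV"
  proof (rule sections_localI[OF vb open_UNIV])
    fix q
    show "\<exists>N v. open N \<and> q \<in> N \<and> v \<in> sections E N \<and> (\<forall>q\<in>N. fmult b u q = v q)"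
    proof (cases "q \<in> W")
      case True
      then show ?thesis
        using sections_fmult[OF vb W assms(2) smooth_funs_mono[OF b(1)]] W by auto
    next
      case False
      have "0 \<in> sections E (- C)"
        using sections_zero[OF vb open_Compl[OF b(2)]] .
      then show ?thesis
        using b False by (intro exI[of _ "- C"] exI[of _ 0]) (auto simp: open_Compl fmult_def)
    qed
  qed
  moreover have "\<forall>\<^sub>F q in nhds p. fmult b u q = u q"
    using b(5) by eventually_elim (simp add: fmult_def)
  ultimately show ?thesis by blast
qed

lemma one_forms_smooth:
  "\<alpha> \<in> one_forms E W \<Longrightarrow> open V \<Longrightarrow> V \<subseteq> W \<Longrightarrow> u \<in> sections E V
    \<Longrightarrow> (\<lambda>p. \<alpha> p (u p)) \<in> smooth_funs (atlas E) V"
  by (simp add: one_forms_def)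

lemma one_forms_zero: "0 \<in> one_forms E W"
  by (auto simp: one_forms_def linear_over_def smooth_funs_const[OF smooth])

lemma one_forms_add: "\<alpha> \<in> one_forms E W \<Longrightarrow> \<beta> \<in> one_forms E W \<Longrightarrow> \<alpha> + \<beta> \<in> one_forms E W"
  by (auto simp: one_forms_def linear_over_def algebra_simps intro!: smooth_funs_add[OF smooth])

lemma one_forms_mult:
  "\<alpha> \<in> one_forms E W \<Longrightarrow> f \<in> smooth_funs (atlas E) W \<Longrightarrow> (\<lambda>p e. f p * \<alpha> p e) \<in> one_forms E W"
  by (auto simp: one_forms_def linear_over_def algebra_simps
      intro!: smooth_funs_mult[OF smooth] intro: smooth_funs_mono)

lemma one_forms_sum: "(\<And>i. i \<in> I \<Longrightarrow> \<alpha> i \<in> one_forms E W) \<Longrightarrow> (\<Sum>i\<in>I. \<alpha> i) \<in> one_forms E W"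
  by (induction I rule: infinite_finite_induct) (simp_all add: one_forms_zero one_forms_add)

text \<open>The same cut-off as for sections; but smoothness of a one-form is tested on sections
  over every open V, so the cover by W and the complement of C is used at the points of V.\<close>

lemma one_forms_ext:
  assumes "p \<in> W" "\<alpha> \<in> one_forms E W"
  shows "\<exists>\<alpha>'. \<alpha>' \<in> one_forms E UNIV \<and> (\<forall>\<^sub>F q in nhds p. \<alpha>' q = \<alpha> q)"
proof -
  obtain b C where b: "b \<in> smooth_funs (atlas E) UNIV" "closed C" "C \<subseteq> W"
    "\<And>q. q \<notin> C \<Longrightarrow> b q = 0" "\<forall>\<^sub>F q in nhds p. b q = (1::real)"
    using smooth_bump[OF smooth W assms(1)] by blast
  have b0: "b q = 0" if "q \<notin> W" for q
    using b(3,4) that by blast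
  define \<alpha>' where "\<alpha>' q e = b q * \<alpha> q e" for q e
  have "\<alpha>' \<in> one_forms E UNIV"
    unfolding one_forms_def
  proof (safe)
    show "linear_over (fibre E q) (\<alpha>' q)" for q
      using assms(2) b0 by (cases "q \<in> W")
        (auto simp: one_forms_def \<alpha>'_def linear_over_def algebra_simps)
    show "\<alpha>' q e = 0" if "e \<notin> fibre E q" for q e
      using assms(2) b0 that by (cases "q \<in> W") (auto simp: one_forms_def \<alpha>'_def)
    fix V u assume V: "open V" and u: "u \<in> sections E V"
    show "(\<lambda>q. \<alpha>' q (u q)) \<in> smooth_funs (atlas E) V"
    proof (rule smooth_funs_localI[OF smooth V])
      fix q assume q: "q \<in> V"
      show "\<exists>N g. open N \<and> q \<in> N \<and> g \<in> smooth_funs (atlas E) N \<and> (\<forall>q\<in>N. \<alpha>' q (u q) = g q)"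
      proof (cases "q \<in> W")
        case True
        have o: "open (V \<inter> W)" using V W by blast
        have "(\<lambda>q. b q * \<alpha> q (u q)) \<in> smooth_funs (atlas E) (V \<inter> W)"
          by (intro smooth_funs_mult[OF smooth o] smooth_funs_mono[OF b(1)]
              one_forms_smooth[OF assms(2) o] sections_mono[OF u]) auto
        then show ?thesis
          using True q o by (intro exI[of _ "V \<inter> W"] exI) (auto simp: \<alpha>'_def)
      next
        case False
        then show ?thesis
          using b smooth_funs_const[OF smooth, of "- C" 0]
          by (intro exI[of _ "- C"] exI[of _ "\<lambda>_. 0"]) (auto simp: open_Compl \<alpha>'_def)
      qed
    qed
  qed
  moreover have "\<forall>\<^sub>F q in nhds p. \<alpha>' q = \<alpha> q"
    using b(5) by eventually_elim (simp add: \<alpha>'_def fun_eq_iff)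
  ultimately show ?thesis by blast
qed

end

text \<open>The vectors satisfying the expansion form a subspace; by duality it contains every
  \<open>X a p\<close>, and these span the fibre.\<close>

lemma frame_expansion:
  assumes vb: "vector_bundle E" and fr: "local_frame E U X" and co: "dual_coframe E U X e"
    and p: "p \<in> U" and x: "x \<in> fibre E p"
  shows "x = (\<Sum>a<rk E. e a p x *\<^sub>R X a p)"
proof -
  let ?S = "{x \<in> fibre E p. x = (\<Sum>a<rk E. e a p x *\<^sub>R X a p)}"
  note sub = vector_bundle_subspace[OF vb, of p]
  have lin: "linear_over (fibre E p) (e a p)" if "a < rk E" for a
    using co p that by (simp add: dual_coframe_def one_forms_def)
  have span: "span ((\<lambda>a. X a p) ` {..<rk E}) = fibre E p"
    using fr p by (simp add: local_frame_def)
  have X: "X b p \<in> ?S" if b: "b < rk E" for b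
  proof -
    have "(\<Sum>a<rk E. e a p (X b p) *\<^sub>R X a p) = (\<Sum>a<rk E. if a = b then X b p else 0)"
      using co p b by (intro sum.cong) (auto simp: dual_coframe_def)
    also have "\<dots> = X b p"
      using b by simp
    finally show ?thesis
      using span b by (auto intro: span_base)
  qed
  have "subspace ?S"
  proof (rule subspaceI)
    show "0 \<in> ?S"
      using linear_over_0[OF lin sub] subspace_0[OF sub] by simp
    show "y + z \<in> ?S" if "y \<in> ?S" "z \<in> ?S" for y z
    proof -
      have "(\<Sum>a<rk E. e a p (y + z) *\<^sub>R X a p)
          = (\<Sum>a<rk E. e a p y *\<^sub>R X a p) + (\<Sum>a<rk E. e a p z *\<^sub>R X a p)"
        unfolding sum.distrib[symmetric]
        using that lin by (intro sum.cong) (auto simp: linear_over_def scaleR_left_distrib)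
      then show ?thesis
        using that subspace_add[OF sub] by auto
    qed
    show "c *\<^sub>R y \<in> ?S" if "y \<in> ?S" for c y
    proof -
      have "(\<Sum>a<rk E. e a p (c *\<^sub>R y) *\<^sub>R X a p) = c *\<^sub>R (\<Sum>a<rk E. e a p y *\<^sub>R X a p)"
        unfolding scaleR_sum_right
        using that lin by (intro sum.cong) (auto simp: linear_over_def)
      then show ?thesis
        using that subspace_scale[OF sub] by auto
    qed
  qed
  then have "span ((\<lambda>a. X a p) ` {..<rk E}) \<subseteq> ?S"
    using X by (intro span_minimal) auto
  then show ?thesis
    using x span by blast
qed

lemma frame_exists:
  fixes E :: "('m::{t2_space,second_countable_topology}, 'a::real_inner, 'v::real_vector, 'z) vbundle_scheme"
  assumes vb: "vector_bundle E"
  obtains U X e where "p \<in> U" "local_frame E U X" "dual_coframe E U X e"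
proof -
  note sm = vector_bundle_smooth_manifold[OF vb] and sub = vector_bundle_subspace[OF vb]
  have "p \<in> (\<Union>(U, \<Phi>)\<in>trivs E. U)"
    using vb by (simp add: vector_bundle_def)
  then obtain U \<Phi> where U: "(U, \<Phi>) \<in> trivs E" "p \<in> U"
    by blast
  define coords where "coords q e = restrict (\<Phi> q e) {..<rk E}" for q e
  \<comment> \<open>The frame is the preimage of the unit coordinate vectors. The coframe
    \<open>e\<close> consists of the coordinate functionals, cut to 0 off the fibre as
    \<open>one_forms\<close> demands.\<close>
  define X where "X a q = inv_into (fibre E q) (coords q) (\<lambda>i\<in>{..<rk E}. if i = a then 1 else 0)"
    for a :: nat and q
  define e where "e a q x = (if x \<in> fibre E q then \<Phi> q x a else 0)" for a q x
  have bij: "bij_betw (coords q) (fibre E q) ({..<rk E} \<rightarrow>\<^sub>E UNIV)" if "q \<in> U" for q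
    using triv_bij[OF vb U(1) that] by (simp add: coords_def[abs_def])
  have lin: "linear_over (fibre E q) (\<lambda>e. \<Phi> q e i)" if "q \<in> U" "i < rk E" for q i
    using triv_linear[OF vb U(1) that] .
  have ran: "(\<lambda>i\<in>{..<rk E}. if i = a then 1 else 0) \<in> coords q ` fibre E q" if "q \<in> U" for a q
    using bij[OF that] by (auto simp: bij_betw_def)
  have X_fibre: "X a q \<in> fibre E q" if "q \<in> U" for a q
    unfolding X_def using ran[OF that] by (rule inv_into_into)
  have coord_X: "\<Phi> q (X a q) i = (if i = a then 1 else 0)" if "q \<in> U" "i < rk E" for a q i
  proof -
    have "coords q (X a q) = (\<lambda>i\<in>{..<rk E}. if i = a then 1 else 0)"
      unfolding X_def using ran[OF that(1)] by (rule f_inv_into_f)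
    then show ?thesis
      using that(2) by (auto simp: coords_def dest!: fun_cong[of _ _ i])
  qed
  have expand: "x = (\<Sum>a<rk E. \<Phi> q x a *\<^sub>R X a q)" if q: "q \<in> U" and x: "x \<in> fibre E q" for q x
  proof (rule inj_onD[of "coords q" "fibre E q"])
    show "inj_on (coords q) (fibre E q)" using bij[OF q] by (simp add: bij_betw_def)
    show "x \<in> fibre E q" by fact
    show "(\<Sum>a<rk E. \<Phi> q x a *\<^sub>R X a q) \<in> fibre E q"
      using X_fibre[OF q] by (intro subspace_sum[OF sub] subspace_scale[OF sub])
    have "\<Phi> q (\<Sum>a<rk E. \<Phi> q x a *\<^sub>R X a q) i = \<Phi> q x i" if i: "i < rk E" for i
      unfolding linear_over_sum[OF lin[OF q i] sub X_fibre[OF q]]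
      using i by (simp add: coord_X[OF q i] if_distrib[of "\<lambda>t. _ * t"] cong: if_cong)
    then show "coords q x = coords q (\<Sum>a<rk E. \<Phi> q x a *\<^sub>R X a q)"
      by (auto simp: coords_def)
  qed
  have X_sec: "X a \<in> sections E U" if a: "a < rk E" for a
    unfolding sections_def
  proof (safe)
    show "X a q \<in> fibre E q" if "q \<in> U" for q by (rule X_fibre[OF that])
    fix V \<Psi> i assume V: "(V, \<Psi>) \<in> trivs E" and i: "i < rk E"
    \<comment> \<open>In another trivialization the coordinates of \<open>X a\<close> are the a-th
      column of the transition matrix, hence smooth.\<close>
    have "\<forall>(U, \<Phi>)\<in>trivs E. \<forall>(V, \<Psi>)\<in>trivs E. \<exists>g.
        (\<forall>i<rk E. \<forall>j<rk E. g i j \<in> smooth_funs (atlas E) (U \<inter> V)) \<and>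
        (\<forall>p\<in>U \<inter> V. \<forall>e\<in>fibre E p. \<forall>i<rk E. \<Psi> p e i = (\<Sum>j<rk E. g i j p * \<Phi> p e j))"
      using vb by (simp add: vector_bundle_def)
    with U(1) V obtain g where g: "\<forall>i<rk E. \<forall>j<rk E. g i j \<in> smooth_funs (atlas E) (U \<inter> V)"
      "\<forall>p\<in>U \<inter> V. \<forall>e\<in>fibre E p. \<forall>i<rk E. \<Psi> p e i = (\<Sum>j<rk E. g i j p * \<Phi> p e j)"
      by blast
    show "(\<lambda>q. \<Psi> q (X a q) i) \<in> smooth_funs (atlas E) (V \<inter> U)"
    proof (rule smooth_funs_cong[OF sm])
      show "open (V \<inter> U)" using triv_open[OF vb] U V by blast
      show "g i a \<in> smooth_funs (atlas E) (V \<inter> U)" using g(1) i a by (simp add: Int_commute)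
      show "\<Psi> q (X a q) i = g i a q" if "q \<in> V \<inter> U" for q
        using g(2) that i a X_fibre by (simp add: coord_X if_distrib[of "\<lambda>t. _ * t"] cong: if_cong)
    qed
  qed
  have "independent ((\<lambda>a. X a q) ` {..<rk E}) \<and> inj_on (\<lambda>a. X a q) {..<rk E}" if q: "q \<in> U" for q
  proof
    show inj: "inj_on (\<lambda>a. X a q) {..<rk E}"
      using coord_X[OF q] by (intro inj_onI) (metis lessThan_iff zero_neq_one)
    have "c (X b q) = 0" if c: "(\<Sum>a<rk E. c (X a q) *\<^sub>R X a q) = 0" and b: "b < rk E" for c b
    proof -
      have "c (X b q) = (\<Sum>a<rk E. c (X a q) * \<Phi> q (X a q) b)"
        using b by (simp add: coord_X[OF q b] if_distrib[of "\<lambda>t. _ * t"] cong: if_cong)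
      also have "\<dots> = \<Phi> q 0 b"
        unfolding c[symmetric] by (rule linear_over_sum[OF lin[OF q b] sub X_fibre[OF q], symmetric])
      finally show ?thesis
        using linear_over_0[OF lin[OF q b] sub] by simp
    qed
    then show "independent ((\<lambda>a. X a q) ` {..<rk E})"
      by (auto simp: dependent_finite sum.reindex[OF inj])
  qed
  moreover have "span ((\<lambda>a. X a q) ` {..<rk E}) = fibre E q" if q: "q \<in> U" for q
  proof
    show "span ((\<lambda>a. X a q) ` {..<rk E}) \<subseteq> fibre E q"
      using X_fibre[OF q] by (intro span_minimal sub) auto
    show "fibre E q \<subseteq> span ((\<lambda>a. X a q) ` {..<rk E})"
    proof
      fix x assume x: "x \<in> fibre E q"
      have "(\<Sum>a<rk E. \<Phi> q x a *\<^sub>R X a q) \<in> span ((\<lambda>a. X a q) ` {..<rk E})"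
        by (intro span_sum span_scale span_base) auto
      then show "x \<in> span ((\<lambda>a. X a q) ` {..<rk E})"
        using expand[OF q x] by simp
    qed
  qed
  ultimately have "local_frame E U X"
    using X_sec triv_open[OF vb U(1)] by (auto simp: local_frame_def)
  moreover have "dual_coframe E U X e"
    unfolding dual_coframe_def
  proof (safe)
    fix a assume a: "a < rk E"
    have lin': "linear_over (fibre E q) (e a q)" if "q \<in> U" for q
      using lin[OF that a] subspace_add[OF sub] subspace_scale[OF sub]
      by (simp add: linear_over_def e_def)
    have "(\<lambda>q. e a q (u q)) \<in> smooth_funs (atlas E) V"
      if V: "open V" "V \<subseteq> U" and u: "u \<in> sections E V" for V u
    proof (rule smooth_funs_cong[OF sm V(1)])
      show "(\<lambda>q. \<Phi> q (u q) a) \<in> smooth_funs (atlas E) V"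
        using sections_coord[OF u U(1) a] V(2) by (simp add: Int_absorb1)
      show "e a q (u q) = \<Phi> q (u q) a" if "q \<in> V" for q
        using sections_fibre[OF u that] by (simp add: e_def)
    qed
    then show "e a \<in> one_forms E U"
      using lin' by (auto simp: one_forms_def e_def)
  next
    fix q a b assume "q \<in> U" "a < rk E" "b < rk E"
    then show "e a q (X b q) = (if a = b then 1 else 0)"
      using X_fibre coord_X by (simp add: e_def)
  qed
  ultimately show ?thesis
    using that[OF U(2)] by blast
qed

section \<open>Locality of the operators of an algebroid\<close>

definition same_germ :: "'m::topological_space \<Rightarrow> ('m \<Rightarrow> 'b) \<Rightarrow> ('m \<Rightarrow> 'b) \<Rightarrow> bool" where
  "same_germ p s t \<longleftrightarrow> (\<forall>\<^sub>F q in nhds p. s q = t q)"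

lemma same_germ_refl [simp]: "same_germ p s s"
  by (simp add: same_germ_def)

lemma same_germ_sym: "same_germ p s t \<Longrightarrow> same_germ p t s"
  by (simp add: same_germ_def eq_commute)

lemma same_germ_trans: "same_germ p s t \<Longrightarrow> same_germ p t r \<Longrightarrow> same_germ p s r"
  unfolding same_germ_def by (auto elim: eventually_elim2)

lemma same_germ_at: "same_germ p s t \<Longrightarrow> s p = t p"
  unfolding same_germ_def by (rule eventually_nhds_x_imp_x)

text \<open>Equality near p is also equality near each point close to p. Every later passage from
  values to germs uses this openness.\<close>

lemma same_germ_nearby: "same_germ p s t \<Longrightarrow> \<forall>\<^sub>F q in nhds p. same_germ q s t"
  unfolding same_germ_def by (simp add: eventually_eventually)

lemma germ_ext_works:
  assumes "s' \<in> S" "same_germ p s' s"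
  shows "germ_ext S p s \<in> S" "same_germ p (germ_ext S p s) s"
proof -
  have "\<exists>s'. s' \<in> S \<and> (\<forall>\<^sub>F q in nhds p. s' q = s q)"
    using assms by (auto simp: same_germ_def)
  from someI_ex[OF this, folded germ_ext_def]
  show "germ_ext S p s \<in> S" "same_germ p (germ_ext S p s) s"
    by (auto simp: same_germ_def)
qed

lemma sum_fun_apply: "(\<Sum>i\<in>I. f i) x = (\<Sum>i\<in>I. f i x)"
  by (induction I rule: infinite_finite_induct) simp_all

lemma additive_sum:
  fixes F :: "'c::comm_monoid_add \<Rightarrow> 'b::ab_group_add"
  assumes "0 \<in> S" "\<And>x y. x \<in> S \<Longrightarrow> y \<in> S \<Longrightarrow> x + y \<in> S"
    and "\<And>x y. x \<in> S \<Longrightarrow> y \<in> S \<Longrightarrow> F (x + y) = F x + F y"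
    and "\<And>i. i \<in> I \<Longrightarrow> x i \<in> S"
  shows "F (\<Sum>i\<in>I. x i) = (\<Sum>i\<in>I. F (x i))"
proof -
  have "F 0 = 0" using assms(3)[OF assms(1,1)] by simp
  then have "(\<Sum>i\<in>I. x i) \<in> S \<and> F (\<Sum>i\<in>I. x i) = (\<Sum>i\<in>I. F (x i))"
    using assms(4)
    by (induction I rule: infinite_finite_induct) (simp_all add: assms(1-3))
  then show ?thesis ..
qed

text \<open>The difference of the two arguments vanishes near \<open>p\<close>, so some bump function kills it.\<close>

lemma local_functional:
  fixes \<A> :: "('m::{t2_space,second_countable_topology}, 'a::real_inner) chart set"
    and S :: "('m \<Rightarrow> 'c::ab_group_add) set"
    and F :: "('m \<Rightarrow> 'c) \<Rightarrow> 'b::ab_group_add"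
    and scale :: "real \<Rightarrow> 'c \<Rightarrow> 'c"
  assumes sm: "smooth_manifold \<A>"
    and diff: "\<And>u v. u \<in> S \<Longrightarrow> v \<in> S \<Longrightarrow> u - v \<in> S"
    and add: "\<And>u v. u \<in> S \<Longrightarrow> v \<in> S \<Longrightarrow> F (u + v) = F u + F v"
    and sc: "\<And>x. scale 0 x = 0" "\<And>c. scale c 0 = 0"
    and leib: "\<And>f u. f \<in> smooth_funs \<A> UNIV \<Longrightarrow> u \<in> S \<Longrightarrow> f p = 1 \<Longrightarrow> u p = 0
      \<Longrightarrow> F (\<lambda>q. scale (f q) (u q)) = F u"
    and uv: "u \<in> S" "v \<in> S" "same_germ p u v"
  shows "F u = F v"
proof -
  obtain W where W: "open W" "p \<in> W" "\<forall>q\<in>W. u q = v q"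
    using uv(3) by (auto simp: same_germ_def eventually_nhds)
  obtain b C where b: "b \<in> smooth_funs \<A> UNIV" "closed C" "C \<subseteq> W"
    "\<And>q. q \<notin> C \<Longrightarrow> b q = 0" "\<forall>\<^sub>F q in nhds p. b q = (1::real)"
    using smooth_bump[OF sm W(1,2)] by blast
  have "scale (b q) ((u - v) q) = 0" for q
  proof (cases "q \<in> W")
    case False
    then have "b q = 0" using b(3,4) by blast
    then show ?thesis using sc by simp
  qed (use W(3) sc in auto)
  then have "(\<lambda>q. scale (b q) ((u - v) q)) = 0"
    by (simp add: fun_eq_iff)
  moreover have "b p = 1"
    using b(5) by (rule eventually_nhds_x_imp_x)
  ultimately have "F 0 = F (u - v)"
    using leib[OF b(1) diff[OF uv(1,2)]] W by auto
  moreover have "0 \<in> S"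
    using diff[OF uv(1,1)] by simp
  then have "F 0 = 0"
    using add[of 0 0] by simp
  ultimately show ?thesis
    using add[OF uv(2) diff[OF uv(1,2)]] by simp
qed

locale connected_algebroid =
  fixes A :: "('m::{t2_space,second_countable_topology}, 'a::real_inner, 'v::real_vector) algebroid"
    and P :: "('m \<Rightarrow> 'v) \<Rightarrow> 'm \<Rightarrow> 'v"
    and nabla :: "('m \<Rightarrow> 'v) \<Rightarrow> ('m \<Rightarrow> 'v) \<Rightarrow> 'm \<Rightarrow> 'v"
  assumes alg: "local_pre_leibniz_algebroid A"
    and proj: "locality_projector A P"
    and conn: "linear_connection A nabla"
    and adm: "admissible A nabla"
begin

abbreviation "C \<equiv> cinf A"
abbreviation "G \<equiv> gsec A"
abbreviation "\<Omega>1 \<equiv> one_forms A UNIV"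
abbreviation "\<rho> \<equiv> rho A"
abbreviation "K \<equiv> L_contr A nabla"
abbreviation "mb \<equiv> mod_bracket A P nabla"
abbreviation "T \<equiv> torsion A P nabla"
abbreviation "R \<equiv> curvature A P nabla"

lemma pre: "pre_leibniz_algebroid A" and anch: "anchored_bundle A" and vb: "vector_bundle A"
  using alg by (auto simp: local_pre_leibniz_algebroid_def pre_leibniz_algebroid_def anchored_bundle_def)

lemmas sm = vector_bundle_smooth_manifold[OF vb]
lemmas sub = vector_bundle_subspace[OF vb]

lemmas C_const = smooth_funs_const[OF sm open_UNIV]

lemma C_diff: "f \<in> C \<Longrightarrow> g \<in> C \<Longrightarrow> f - g \<in> C"
  using smooth_funs_diff[OF sm open_UNIV] by (simp add: fun_diff_def)

lemmas G_zero = sections_zero[OF vb open_UNIV]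
lemmas G_add = sections_add[OF vb open_UNIV]
lemmas G_fmult = sections_fmult[OF vb open_UNIV]
lemmas G_uminus = sections_uminus[OF vb open_UNIV]
lemmas G_diff = sections_diff[OF vb open_UNIV]
lemmas G_sum = sections_sum[OF vb open_UNIV]

lemma G_fibre: "u \<in> G \<Longrightarrow> u p \<in> fibre A p"
  by (simp add: sections_fibre)

lemma \<Omega>1_linear: "\<alpha> \<in> \<Omega>1 \<Longrightarrow> linear_over (fibre A p) (\<alpha> p)"
  by (simp add: one_forms_def)

lemma \<Omega>1_smooth: "\<alpha> \<in> \<Omega>1 \<Longrightarrow> u \<in> G \<Longrightarrow> (\<lambda>q. \<alpha> q (u q)) \<in> C"
  by (simp add: one_forms_def)

lemma \<Omega>1_at:
  assumes "\<alpha> \<in> \<Omega>1" "x \<in> fibre A p"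
  shows \<Omega>1_at_uminus: "\<alpha> p (- x) = - \<alpha> p x"
    and \<Omega>1_at_add: "y \<in> fibre A p \<Longrightarrow> \<alpha> p (x + y) = \<alpha> p x + \<alpha> p y"
    and \<Omega>1_at_diff: "y \<in> fibre A p \<Longrightarrow> \<alpha> p (x - y) = \<alpha> p x - \<alpha> p y"
proof -
  have add: "\<alpha> p (x + y) = \<alpha> p x + \<alpha> p y" if "x \<in> fibre A p" "y \<in> fibre A p" for x y
    using \<Omega>1_linear[OF assms(1)] that by (simp add: linear_over_def)
  show neg: "\<alpha> p (- x) = - \<alpha> p x"
    using add[OF assms(2) subspace_neg[OF sub assms(2)]]
      linear_over_0[OF \<Omega>1_linear[OF assms(1)] sub, of p] by simp
  assume y: "y \<in> fibre A p"
  show "\<alpha> p (x + y) = \<alpha> p x + \<alpha> p y" by (rule add[OF assms(2) y])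
  show "\<alpha> p (x - y) = \<alpha> p x - \<alpha> p y"
    using add[OF subspace_diff[OF sub assms(2) y] y] by simp
qed

lemma \<Omega>1_diff:
  assumes "\<alpha> \<in> \<Omega>1" "\<beta> \<in> \<Omega>1"
  shows "\<alpha> - \<beta> \<in> \<Omega>1"
proof -
  have eq: "\<alpha> - \<beta> = \<alpha> + (\<lambda>p e. -1 * \<beta> p e)"
    by (simp add: fun_eq_iff)
  show ?thesis
    unfolding eq by (intro one_forms_add one_forms_mult vb open_UNIV assms C_const)
qed

subsection \<open>The anchor\<close>

lemma anchor_linear: "linear_over (fibre A p) (\<lambda>e. anchor A p e f)"
  using anch by (simp add: anchored_bundle_def)

lemma anchor_tangent: "e \<in> fibre A p \<Longrightarrow> anchor A p e \<in> tangent_space (atlas A) p"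
  using anch by (simp add: anchored_bundle_def)

lemma \<rho>_closed: "u \<in> G \<Longrightarrow> f \<in> C \<Longrightarrow> \<rho> u f \<in> C"
  using anch by (simp add: anchored_bundle_def)

lemma \<rho>_add: "u \<in> G \<Longrightarrow> f \<in> C \<Longrightarrow> g \<in> C \<Longrightarrow> \<rho> u (f + g) = \<rho> u f + \<rho> u g"
  using anchor_tangent[OF G_fibre] by (simp add: rho_def tangent_space_def fun_eq_iff)

lemma \<rho>_diff:
  assumes "u \<in> G" "f \<in> C" "g \<in> C"
  shows "\<rho> u (f - g) = \<rho> u f - \<rho> u g"
  using \<rho>_add[OF assms(1) C_diff[OF assms(2,3)] assms(3)] by simp

text \<open>A derivation at p sends f g with f(p) = 1 and g(p) = 0 to its value on g, which is the
  multiplicative condition of \<open>local_functional\<close>.\<close>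

lemma \<rho>_local:
  assumes "u \<in> G" "f \<in> C" "g \<in> C" "same_germ p f g"
  shows "\<rho> u f p = \<rho> u g p"
proof (rule local_functional[where F = "\<lambda>f. \<rho> u f p" and scale = "(*)", OF sm C_diff])
  show "\<rho> u (\<lambda>q. f q * g q) p = \<rho> u g p" if "f \<in> C" "g \<in> C" "f p = 1" "g p = 0" for f g
  proof -
    have "anchor A p (u p) (f * g) = anchor A p (u p) f * g p + f p * anchor A p (u p) g"
      using anchor_tangent[OF G_fibre[OF assms(1)]] that by (simp add: tangent_space_def)
    then show ?thesis
      using that by (simp add: rho_def times_fun_def)
  qed
qed (use assms in \<open>auto simp: \<rho>_add\<close>)

subsection \<open>The connection\<close>

lemma nabla_closed: "u \<in> G \<Longrightarrow> v \<in> G \<Longrightarrow> nabla u v \<in> G"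
  and nabla_add_left: "u \<in> G \<Longrightarrow> u' \<in> G \<Longrightarrow> v \<in> G \<Longrightarrow> nabla (u + u') v = nabla u v + nabla u' v"
  and nabla_add_right: "u \<in> G \<Longrightarrow> v \<in> G \<Longrightarrow> v' \<in> G \<Longrightarrow> nabla u (v + v') = nabla u v + nabla u v'"
  and nabla_leibniz: "u \<in> G \<Longrightarrow> v \<in> G \<Longrightarrow> f \<in> C
    \<Longrightarrow> nabla u (fmult f v) = fmult (\<rho> u f) v + fmult f (nabla u v)"
  and nabla_fmult_left: "u \<in> G \<Longrightarrow> v \<in> G \<Longrightarrow> f \<in> C \<Longrightarrow> nabla (fmult f u) v = fmult f (nabla u v)"
  using conn by (auto simp: linear_connection_def real_bilinear_on_def)

lemma nabla_diff_right:
  assumes "u \<in> G" "v \<in> G" "w \<in> G"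
  shows "nabla u (v - w) = nabla u v - nabla u w"
  using nabla_add_right[OF assms(1) G_diff[OF assms(2,3)] assms(3)] by simp

lemma nabla_uminus_left:
  assumes "u \<in> G" "v \<in> G"
  shows "nabla (- u) v = - nabla u v"
  using nabla_add_left[OF assms(1) G_uminus[OF assms(1)] assms(2)]
    nabla_add_left[OF G_zero G_zero assms(2)] by (simp add: eq_neg_iff_add_eq_0 add.commute)

text \<open>In the second argument the Leibniz rule suffices: if f(p) = 1 and v(p) = 0, the term
  with the derivative of f carries the factor v(p) and vanishes at p. The first argument is linear
  over functions.\<close>

lemma nabla_local:
  assumes "u \<in> G" "u' \<in> G" "v \<in> G" "v' \<in> G" "same_germ p u u'" "same_germ p v v'"
  shows "nabla u v p = nabla u' v' p"
proof -
  have "nabla u v p = nabla u' v p"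
    by (rule local_functional[where F = "\<lambda>u. nabla u v p" and scale = scaleR, OF sm G_diff])
      (use assms in \<open>auto simp: nabla_add_left nabla_fmult_left[unfolded fmult_def]\<close>)
  also have "\<dots> = nabla u' v' p"
    by (rule local_functional[where F = "\<lambda>v. nabla u' v p" and scale = scaleR, OF sm G_diff])
      (use assms in \<open>auto simp: nabla_add_right nabla_leibniz[unfolded fmult_def]\<close>)
  finally show ?thesis .
qed

text \<open>Locality at every point near p upgrades equal values to equal germs, as iterated
  derivatives require.\<close>

lemma nabla_germ:
  assumes "u \<in> G" "u' \<in> G" "v \<in> G" "v' \<in> G" "same_germ p u u'" "same_germ p v v'"
  shows "same_germ p (nabla u v) (nabla u' v')"
  unfolding same_germ_def
  using same_germ_nearby[OF assms(5)] same_germ_nearby[OF assms(6)]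
  by eventually_elim (rule nabla_local[OF assms(1-4)])

subsection \<open>Frames and contraction\<close>

text \<open>Global objects that are dual frames only near p, because a global frame need not exist.
  Being stated on a neighbourhood, the property passes to nearby points, so one frame serves them
  all.\<close>

definition frame_at :: "'m \<Rightarrow> (nat \<Rightarrow> 'm \<Rightarrow> 'v) \<Rightarrow> (nat \<Rightarrow> 'm \<Rightarrow> 'v \<Rightarrow> real) \<Rightarrow> bool" where
  "frame_at p Y \<alpha> \<longleftrightarrow> (\<forall>a<rk A. Y a \<in> G \<and> \<alpha> a \<in> \<Omega>1) \<and>
     (\<forall>\<^sub>F q in nhds p. (\<forall>a<rk A. \<forall>b<rk A. \<alpha> a q (Y b q) = (if a = b then 1 else 0)) \<and>
        (\<forall>x\<in>fibre A q. x = (\<Sum>a<rk A. \<alpha> a q x *\<^sub>R Y a q)))"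

lemma frame_at_closed:
  assumes "frame_at p Y \<alpha>" "a < rk A"
  shows "Y a \<in> G" "\<alpha> a \<in> \<Omega>1"
  using assms by (auto simp: frame_at_def)

lemma frame_at_dual:
  "frame_at p Y \<alpha> \<Longrightarrow> a < rk A \<Longrightarrow> b < rk A \<Longrightarrow> \<alpha> a p (Y b p) = (if a = b then 1 else 0)"
  unfolding frame_at_def using eventually_nhds_x_imp_x by fastforce

lemma frame_at_nearby: "frame_at p Y \<alpha> \<Longrightarrow> \<forall>\<^sub>F q in nhds p. frame_at q Y \<alpha>"
  unfolding frame_at_def by (simp add: eventually_eventually)

lemma frame_at_extension:
  assumes fr: "local_frame A U X" and co: "dual_coframe A U X e" and p: "p \<in> U"
    and Y: "\<And>a. a < rk A \<Longrightarrow> Y a \<in> G \<and> same_germ p (Y a) (X a)"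
    and \<alpha>: "\<And>a. a < rk A \<Longrightarrow> \<alpha> a \<in> \<Omega>1 \<and> same_germ p (\<alpha> a) (e a)"
  shows "frame_at p Y \<alpha>"
proof -
  have "open U" using fr by (simp add: local_frame_def)
  then have 1: "\<forall>\<^sub>F q in nhds p. q \<in> U"
    using p by (rule eventually_nhds_in_open)
  have 2: "\<forall>\<^sub>F q in nhds p. \<forall>a\<in>{..<rk A}. Y a q = X a q \<and> \<alpha> a q = e a q"
    using Y \<alpha> by (intro eventually_ball_finite) (auto simp: same_germ_def eventually_conj)
  have "\<forall>\<^sub>F q in nhds p. (\<forall>a<rk A. \<forall>b<rk A. \<alpha> a q (Y b q) = (if a = b then 1 else 0)) \<and>
        (\<forall>x\<in>fibre A q. x = (\<Sum>a<rk A. \<alpha> a q x *\<^sub>R Y a q))"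
    using 1 2
  proof eventually_elim
    case (elim q)
    have "(\<Sum>a<rk A. \<alpha> a q x *\<^sub>R Y a q) = (\<Sum>a<rk A. e a q x *\<^sub>R X a q)" for x
      using elim(2) by (intro sum.cong) auto
    then show ?case
      using elim co frame_expansion[OF vb fr co elim(1)] by (auto simp: dual_coframe_def)
  qed
  then show ?thesis
    using Y \<alpha> by (auto simp: frame_at_def)
qed

lemma extend_frame:
  assumes fr: "local_frame A U X" and co: "dual_coframe A U X e" and p: "p \<in> U" and a: "a < rk A"
  shows "\<exists>Y. Y \<in> G \<and> same_germ p Y (X a)" "\<exists>\<alpha>. \<alpha> \<in> \<Omega>1 \<and> same_germ p \<alpha> (e a)"
proof -
  have "open U" "X a \<in> sections A U" "e a \<in> one_forms A U"
    using fr co a by (auto simp: local_frame_def dual_coframe_def)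
  then show "\<exists>Y. Y \<in> G \<and> same_germ p Y (X a)" "\<exists>\<alpha>. \<alpha> \<in> \<Omega>1 \<and> same_germ p \<alpha> (e a)"
    using sections_ext[OF vb _ p] one_forms_ext[OF vb _ p] by (auto simp: same_germ_def)
qed

lemma frame_at_exists:
  obtains Y \<alpha> where "frame_at p Y \<alpha>"
proof -
  obtain U X e where U: "p \<in> U" "local_frame A U X" "dual_coframe A U X e"
    using frame_exists[OF vb] by blast
  obtain Y where "\<forall>a<rk A. Y a \<in> G \<and> same_germ p (Y a) (X a)"
    using extend_frame(1)[OF U(2,3,1)] by metis
  moreover obtain \<alpha> where "\<forall>a<rk A. \<alpha> a \<in> \<Omega>1 \<and> same_germ p (\<alpha> a) (e a)"
    using extend_frame(2)[OF U(2,3,1)] by metis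
  ultimately show ?thesis
    using frame_at_extension[OF U(2,3,1)] that by blast
qed

text \<open>Near p, but not globally, s is the sum of its frame components, so locality must come
  before additivity. F need not be linear over functions, which lets the lemma serve both the
  curvature and \<nabla>.\<close>

lemma section_expansion:
  fixes F :: "('m \<Rightarrow> 'v) \<Rightarrow> 'b::ab_group_add"
  assumes fr: "frame_at p Y \<alpha>" and s: "s \<in> G"
    and add: "\<And>u v. u \<in> G \<Longrightarrow> v \<in> G \<Longrightarrow> F (u + v) = F u + F v"
    and loc: "\<And>u v. u \<in> G \<Longrightarrow> v \<in> G \<Longrightarrow> same_germ p u v \<Longrightarrow> F u = F v"
  shows "F s = (\<Sum>b<rk A. F (fmult (\<lambda>q. \<alpha> b q (s q)) (Y b)))"
proof -
  have cl: "fmult (\<lambda>q. \<alpha> b q (s q)) (Y b) \<in> G" if "b < rk A" for b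
    using frame_at_closed[OF fr that] s by (intro G_fmult \<Omega>1_smooth)
  have "same_germ p s (\<Sum>b<rk A. fmult (\<lambda>q. \<alpha> b q (s q)) (Y b))"
  proof -
    have "\<forall>\<^sub>F q in nhds p. \<forall>x\<in>fibre A q. x = (\<Sum>a<rk A. \<alpha> a q x *\<^sub>R Y a q)"
      using fr by (auto simp: frame_at_def eventually_conj_iff)
    then show ?thesis
      unfolding same_germ_def
      by eventually_elim (use G_fibre[OF s] in \<open>simp add: sum_fun_apply fmult_def\<close>)
  qed
  then have "F s = F (\<Sum>b<rk A. fmult (\<lambda>q. \<alpha> b q (s q)) (Y b))"
    using cl by (intro loc s G_sum) auto
  also have "\<dots> = (\<Sum>b<rk A. F (fmult (\<lambda>q. \<alpha> b q (s q)) (Y b)))"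
    by (rule additive_sum[where F = F and S = G]) (auto intro: G_zero G_add add cl)
  finally show ?thesis .
qed


lemma coframe_expansion:
  fixes F :: "('m \<Rightarrow> 'v \<Rightarrow> real) \<Rightarrow> 'b::ab_group_add"
  assumes fr: "frame_at p Y \<alpha>" and \<beta>: "\<beta> \<in> \<Omega>1"
    and add: "\<And>\<beta> \<gamma>. \<beta> \<in> \<Omega>1 \<Longrightarrow> \<gamma> \<in> \<Omega>1 \<Longrightarrow> F (\<beta> + \<gamma>) = F \<beta> + F \<gamma>"
    and loc: "\<And>\<beta> \<gamma>. \<beta> \<in> \<Omega>1 \<Longrightarrow> \<gamma> \<in> \<Omega>1 \<Longrightarrow> same_germ p \<beta> \<gamma> \<Longrightarrow> F \<beta> = F \<gamma>"
  shows "F \<beta> = (\<Sum>b<rk A. F (\<lambda>q e. \<beta> q (Y b q) * \<alpha> b q e))"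
proof -
  let ?g = "\<lambda>b q e. \<beta> q (Y b q) * \<alpha> b q e"
  have cl: "?g b \<in> \<Omega>1" if "b < rk A" for b
    using frame_at_closed[OF fr that] \<beta> by (intro one_forms_mult[OF vb open_UNIV] \<Omega>1_smooth)
  have "\<forall>\<^sub>F q in nhds p. \<forall>x\<in>fibre A q. x = (\<Sum>a<rk A. \<alpha> a q x *\<^sub>R Y a q)"
    using fr by (auto simp: frame_at_def eventually_conj_iff)
  then have "same_germ p \<beta> (\<Sum>b<rk A. ?g b)"
    unfolding same_germ_def
  proof eventually_elim
    case (elim q)
    show ?case
    proof
      fix x
      show "\<beta> q x = (\<Sum>b<rk A. ?g b) q x"
      proof (cases "x \<in> fibre A q")
        case True
        then have "\<beta> q x = \<beta> q (\<Sum>a<rk A. \<alpha> a q x *\<^sub>R Y a q)"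
          using elim by simp
        also have "\<dots> = (\<Sum>a<rk A. \<alpha> a q x * \<beta> q (Y a q))"
          using frame_at_closed(1)[OF fr] by (intro linear_over_sum[OF \<Omega>1_linear[OF \<beta>] sub] G_fibre) auto
        finally show ?thesis
          by (simp add: sum_fun_apply mult.commute)
      next
        \<comment> \<open>Covectors are 0 off the fibre by convention, so the two forms agree as
          functions on the whole type.\<close>
        case False
        then show ?thesis
          using \<beta> frame_at_closed(2)[OF fr] by (simp add: sum_fun_apply one_forms_def)
      qed
    qed
  qed
  then have eq: "F \<beta> = F (\<Sum>b<rk A. ?g b)"
    using cl by (intro loc \<beta> one_forms_sum[OF vb open_UNIV]) auto
  show ?thesis
    unfolding eq by (rule additive_sum[where F = F and S = \<Omega>1])
      (auto intro: one_forms_zero[OF vb open_UNIV] one_forms_add[OF vb open_UNIV] add cl)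
qed

subsection \<open>The locality operator\<close>

lemma locop_closed: "\<alpha> \<in> \<Omega>1 \<Longrightarrow> u \<in> G \<Longrightarrow> v \<in> G \<Longrightarrow> locop A \<alpha> u v \<in> G"
  using alg by (simp add: local_pre_leibniz_algebroid_def)

lemma
  assumes "\<alpha> \<in> \<Omega>1" "u \<in> G" "v \<in> G"
  shows locop_add_form: "\<beta> \<in> \<Omega>1 \<Longrightarrow> locop A (\<alpha> + \<beta>) u v = locop A \<alpha> u v + locop A \<beta> u v"
    and locop_mult_form: "f \<in> C \<Longrightarrow> locop A (\<lambda>p e. f p * \<alpha> p e) u v = fmult f (locop A \<alpha> u v)"
    and locop_add_left: "w \<in> G \<Longrightarrow> locop A \<alpha> (u + w) v = locop A \<alpha> u v + locop A \<alpha> w v"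
    and locop_fmult_left: "f \<in> C \<Longrightarrow> locop A \<alpha> (fmult f u) v = fmult f (locop A \<alpha> u v)"
    and locop_add_right: "w \<in> G \<Longrightarrow> locop A \<alpha> u (v + w) = locop A \<alpha> u v + locop A \<alpha> u w"
    and locop_fmult_right: "f \<in> C \<Longrightarrow> locop A \<alpha> u (fmult f v) = fmult f (locop A \<alpha> u v)"
  using alg assms C_const[of 0] unfolding local_pre_leibniz_algebroid_def by blast+

lemma locop_local_form:
  assumes "\<alpha> \<in> \<Omega>1" "\<beta> \<in> \<Omega>1" "same_germ p \<alpha> \<beta>" "u \<in> G" "v \<in> G"
  shows "locop A \<alpha> u v p = locop A \<beta> u v p"
  by (rule local_functional[where F = "\<lambda>\<alpha>. locop A \<alpha> u v p" and scale = "\<lambda>c \<alpha> e. c * \<alpha> e", OF sm \<Omega>1_diff])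
    (use assms in \<open>auto simp: locop_add_form locop_mult_form fmult_def\<close>)

lemma locop_local_left:
  assumes "\<alpha> \<in> \<Omega>1" "u \<in> G" "u' \<in> G" "same_germ p u u'" "v \<in> G"
  shows "locop A \<alpha> u v p = locop A \<alpha> u' v p"
  by (rule local_functional[where F = "\<lambda>u. locop A \<alpha> u v p" and scale = scaleR, OF sm G_diff])
    (use assms in \<open>auto simp: locop_add_left locop_fmult_left[unfolded fmult_def]\<close>)

text \<open>One matrix, the values of the new coframe on the old frame, expands the new covectors in
  the old ones and the old vectors in the new ones. As L and \<nabla> are linear over functions in
  the contracted slots, both contractions equal the same double sum.\<close>

lemma contraction_frame_independent:
  assumes fr: "frame_at p Y \<alpha>" "frame_at p Y' \<alpha>'" and u: "u \<in> G" and v: "v \<in> G"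
  shows "(\<Sum>c<rk A. locop A (\<alpha>' c) (nabla (Y' c) u) v p) = (\<Sum>a<rk A. locop A (\<alpha> a) (nabla (Y a) u) v p)"
proof -
  let ?B = "\<lambda>\<alpha> Y. locop A \<alpha> (nabla Y u) v p"
  note cl = frame_at_closed[OF fr(1)] frame_at_closed[OF fr(2)]
  have 1: "?B (\<alpha>' c) (Y' c) = (\<Sum>a<rk A. \<alpha>' c p (Y a p) *\<^sub>R ?B (\<alpha> a) (Y' c))" if c: "c < rk A" for c
  proof -
    have "?B (\<alpha>' c) (Y' c) = (\<Sum>a<rk A. ?B (\<lambda>q e. \<alpha>' c q (Y a q) * \<alpha> a q e) (Y' c))"
      using cl c u v
      by (intro coframe_expansion[OF fr(1), where F = "\<lambda>\<alpha>. ?B \<alpha> (Y' c)"])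
        (auto simp: locop_add_form nabla_closed intro!: locop_local_form)
    also have "\<dots> = (\<Sum>a<rk A. \<alpha>' c p (Y a p) *\<^sub>R ?B (\<alpha> a) (Y' c))"
    proof (rule sum.cong)
      fix a assume "a \<in> {..<rk A}"
      then show "?B (\<lambda>q e. \<alpha>' c q (Y a q) * \<alpha> a q e) (Y' c) = \<alpha>' c p (Y a p) *\<^sub>R ?B (\<alpha> a) (Y' c)"
        using cl c u v by (simp add: locop_mult_form[where f = "\<lambda>q. \<alpha>' c q (Y a q)"] nabla_closed \<Omega>1_smooth fmult_def)
    qed simp
    finally show ?thesis .
  qed
  have 2: "?B (\<alpha> a) (Y a) = (\<Sum>c<rk A. \<alpha>' c p (Y a p) *\<^sub>R ?B (\<alpha> a) (Y' c))" if a: "a < rk A" for a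
  proof -
    have "?B (\<alpha> a) (Y a) = (\<Sum>c<rk A. ?B (\<alpha> a) (fmult (\<lambda>q. \<alpha>' c q (Y a q)) (Y' c)))"
      using cl a u v
      by (intro section_expansion[OF fr(2), where F = "\<lambda>Y. ?B (\<alpha> a) Y"])
        (auto simp: nabla_add_left locop_add_left nabla_closed intro!: locop_local_left nabla_germ)
    also have "\<dots> = (\<Sum>c<rk A. \<alpha>' c p (Y a p) *\<^sub>R ?B (\<alpha> a) (Y' c))"
    proof (rule sum.cong)
      fix c assume "c \<in> {..<rk A}"
      then show "?B (\<alpha> a) (fmult (\<lambda>q. \<alpha>' c q (Y a q)) (Y' c)) = \<alpha>' c p (Y a p) *\<^sub>R ?B (\<alpha> a) (Y' c)"
        using cl a u v by (simp add: nabla_fmult_left locop_fmult_left nabla_closed \<Omega>1_smooth) (simp add: fmult_def)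
    qed simp
    finally show ?thesis .
  qed
  have "(\<Sum>c<rk A. ?B (\<alpha>' c) (Y' c)) = (\<Sum>c<rk A. \<Sum>a<rk A. \<alpha>' c p (Y a p) *\<^sub>R ?B (\<alpha> a) (Y' c))"
    using 1 by (intro sum.cong) auto
  also have "\<dots> = (\<Sum>a<rk A. \<Sum>c<rk A. \<alpha>' c p (Y a p) *\<^sub>R ?B (\<alpha> a) (Y' c))"
    by (rule sum.swap)
  also have "\<dots> = (\<Sum>a<rk A. ?B (\<alpha> a) (Y a))"
    using 2 by (intro sum.cong) auto
  finally show ?thesis .
qed

text \<open>Some frame exists around p, so the choice in \<open>L_contr\<close> yields one; frame
  independence then replaces it by any other.\<close>

lemma L_contr_frame:
  assumes fr: "frame_at p Y \<alpha>" and u: "u \<in> G" and v: "v \<in> G"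
  shows "K u v p = (\<Sum>a<rk A. locop A (\<alpha> a) (nabla (Y a) u) v p)"
proof -
  let ?Q = "\<lambda>(U, X, e). p \<in> U \<and> local_frame A U X \<and> dual_coframe A U X e"
  obtain U X e where sel: "(SOME z. ?Q z) = (U, X, e)"
    using prod_cases3 by blast
  obtain U' X' e' where "p \<in> U'" "local_frame A U' X'" "dual_coframe A U' X' e'"
    using frame_exists[OF vb] by blast
  then have "?Q (U', X', e')"
    by simp
  then have "?Q (U, X, e)"
    unfolding sel[symmetric] by (rule someI)
  then have U: "p \<in> U" "local_frame A U X" "dual_coframe A U X e"
    by auto
  let ?Y = "\<lambda>a. ext_sec A p (X a)" and ?\<alpha> = "\<lambda>a. germ_ext \<Omega>1 p (e a)"
  have "frame_at p ?Y ?\<alpha>"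
  proof (rule frame_at_extension[OF U(2,3,1)])
    fix a assume a: "a < rk A"
    show "?Y a \<in> G \<and> same_germ p (?Y a) (X a)" "?\<alpha> a \<in> \<Omega>1 \<and> same_germ p (?\<alpha> a) (e a)"
      using extend_frame[OF U(2,3,1) a] germ_ext_works by blast+
  qed
  from contraction_frame_independent[OF fr this u v]
  show ?thesis
    unfolding L_contr_def sel by simp
qed

text \<open>A frame around p computes the contraction at all nearby points, so K agrees near p with
  one global section. Smoothness of K and the use of P on it come from here.\<close>

lemma L_contr_near:
  assumes u: "u \<in> G" and v: "v \<in> G"
  obtains \<alpha> Y where "\<And>a. a < rk A \<Longrightarrow> \<alpha> a \<in> \<Omega>1 \<and> Y a \<in> G"
    "same_germ p (K u v) (\<Sum>a<rk A. locop A (\<alpha> a) (nabla (Y a) u) v)"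
proof -
  obtain Y \<alpha> where fr: "frame_at p Y \<alpha>" using frame_at_exists .
  have "same_germ p (K u v) (\<Sum>a<rk A. locop A (\<alpha> a) (nabla (Y a) u) v)"
    unfolding same_germ_def using frame_at_nearby[OF fr]
    by eventually_elim (simp add: sum_fun_apply L_contr_frame u v)
  then show ?thesis
    using that frame_at_closed[OF fr] by blast
qed

lemma L_contr_closed:
  assumes u: "u \<in> G" and v: "v \<in> G"
  shows "K u v \<in> G"
proof (rule sections_localI[OF vb open_UNIV])
  fix p
  obtain \<alpha> Y where cl: "\<And>a. a < rk A \<Longrightarrow> \<alpha> a \<in> \<Omega>1 \<and> Y a \<in> G"
    and germ: "same_germ p (K u v) (\<Sum>a<rk A. locop A (\<alpha> a) (nabla (Y a) u) v)" (is "same_germ p _ ?s")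
    using L_contr_near[OF u v] by blast
  have "?s \<in> G"
    using cl u v by (intro G_sum locop_closed nabla_closed) auto
  then show "\<exists>N w. open N \<and> p \<in> N \<and> w \<in> sections A N \<and> (\<forall>q\<in>N. K u v q = w q)"
    using germ sections_mono[OF _ subset_UNIV] unfolding same_germ_def eventually_nhds by blast
qed

lemma L_contr_add_right:
  assumes "u \<in> G" "v \<in> G" "w \<in> G"
  shows "K u (v + w) = K u v + K u w"
proof
  fix p
  obtain Y \<alpha> where fr: "frame_at p Y \<alpha>" using frame_at_exists .
  show "K u (v + w) p = (K u v + K u w) p"
    using assms frame_at_closed[OF fr]
    by (simp add: L_contr_frame[OF fr] G_add locop_add_right nabla_closed sum.distrib)
qed

lemma L_contr_fmult_right:
  assumes "u \<in> G" "v \<in> G" "f \<in> C"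
  shows "K u (fmult f v) = fmult f (K u v)"
proof
  fix p
  obtain Y \<alpha> where fr: "frame_at p Y \<alpha>" using frame_at_exists .
  show "K u (fmult f v) p = fmult f (K u v) p"
    using assms frame_at_closed[OF fr]
    by (simp add: L_contr_frame[OF fr] G_fmult locop_fmult_right nabla_closed)
      (simp add: fmult_def L_contr_frame[OF fr] scaleR_sum_right)
qed

subsection \<open>The projected modified bracket\<close>

lemma proj_closed: "u \<in> G \<Longrightarrow> P u \<in> G"
  and proj_add: "u \<in> G \<Longrightarrow> v \<in> G \<Longrightarrow> P (u + v) = P u + P v"
  and proj_fmult: "u \<in> G \<Longrightarrow> f \<in> C \<Longrightarrow> P (fmult f u) = fmult f (P u)"
  and proj_locop: "\<alpha> \<in> \<Omega>1 \<Longrightarrow> u \<in> G \<Longrightarrow> v \<in> G \<Longrightarrow> anchor A p (P (locop A \<alpha> u v) p) = 0"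
  and proj_kernel: "u \<in> G \<Longrightarrow> (\<And>p. anchor A p (u p) = 0) \<Longrightarrow> P u = u"
  using proj by (auto simp: locality_projector_def zero_fun_def)

lemma proj_local:
  assumes "u \<in> G" "v \<in> G" "same_germ p u v"
  shows "P u p = P v p"
  by (rule local_functional[where F = "\<lambda>u. P u p" and scale = scaleR, OF sm G_diff])
    (use assms in \<open>auto simp: proj_add proj_fmult[unfolded fmult_def]\<close>)

text \<open>The projector condition concerns single values of L, whereas K is a sum of them only
  near p. Locality of P allows the replacement; linearity of P and of the anchor then reduces to the
  summands.\<close>

lemma anchor_proj_L_contr:
  assumes u: "u \<in> G" and v: "v \<in> G"
  shows "anchor A p (P (K u v) p) f = 0"
proof -
  obtain \<alpha> Y where cl: "\<And>a. a < rk A \<Longrightarrow> \<alpha> a \<in> \<Omega>1 \<and> Y a \<in> G"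
    and germ: "same_germ p (K u v) (\<Sum>a<rk A. locop A (\<alpha> a) (nabla (Y a) u) v)" (is "same_germ p _ (\<Sum>a<_. ?s a)")
    using L_contr_near[OF u v] by blast
  have s: "?s a \<in> G" if "a < rk A" for a
    using cl that u v by (intro locop_closed nabla_closed) auto
  have "P (K u v) p = P (\<Sum>a<rk A. ?s a) p"
    using s by (intro proj_local germ L_contr_closed u v G_sum) auto
  \<comment> \<open>The factor 1 gives the linear combination the shape expected by
    \<open>linear_over_sum\<close>.\<close>
  also have "\<dots> = (\<Sum>a<rk A. 1 *\<^sub>R P (?s a) p)"
    using additive_sum[of G P "{..<rk A}" ?s] G_zero G_add proj_add s by (simp add: sum_fun_apply)
  finally have "anchor A p (P (K u v) p) f = (\<Sum>a<rk A. 1 * anchor A p (P (?s a) p) f)"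
    using s by (simp only:) (intro linear_over_sum[OF anchor_linear sub] G_fibre proj_closed, auto)
  then show ?thesis
    using cl u v by (simp add: proj_locop nabla_closed)
qed

lemma bracket_closed: "u \<in> G \<Longrightarrow> v \<in> G \<Longrightarrow> bracket A u v \<in> G"
  and bracket_add_right: "u \<in> G \<Longrightarrow> v \<in> G \<Longrightarrow> w \<in> G \<Longrightarrow> bracket A u (v + w) = bracket A u v + bracket A u w"
  and bracket_leibniz: "u \<in> G \<Longrightarrow> v \<in> G \<Longrightarrow> f \<in> C
    \<Longrightarrow> bracket A u (fmult f v) = fmult (\<rho> u f) v + fmult f (bracket A u v)"
  and \<rho>_bracket: "u \<in> G \<Longrightarrow> v \<in> G \<Longrightarrow> f \<in> C \<Longrightarrow> \<rho> (bracket A u v) f = \<rho> u (\<rho> v f) - \<rho> v (\<rho> u f)"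
  using pre by (auto simp: pre_leibniz_algebroid_def real_bilinear_on_def)

lemma mb_closed: "u \<in> G \<Longrightarrow> v \<in> G \<Longrightarrow> mb u v \<in> G"
  by (simp add: mod_bracket_def G_diff bracket_closed proj_closed L_contr_closed)

lemma mb_add_right: "u \<in> G \<Longrightarrow> v \<in> G \<Longrightarrow> w \<in> G \<Longrightarrow> mb u (v + w) = mb u v + mb u w"
  by (simp add: mod_bracket_def bracket_add_right L_contr_add_right L_contr_closed proj_add)

lemma mb_leibniz: "u \<in> G \<Longrightarrow> v \<in> G \<Longrightarrow> f \<in> C \<Longrightarrow> mb u (fmult f v) = fmult (\<rho> u f) v + fmult f (mb u v)"
  by (simp add: mod_bracket_def bracket_leibniz L_contr_fmult_right proj_fmult L_contr_closed)
    (simp add: fmult_def fun_eq_iff scaleR_diff_right)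

text \<open>The anchor annihilates the subtracted term \<open>P (K u v)\<close>, so the commutator
  property of the original bracket is inherited.\<close>

lemma \<rho>_mb:
  assumes "u \<in> G" "v \<in> G" "f \<in> C"
  shows "\<rho> (mb u v) f = \<rho> u (\<rho> v f) - \<rho> v (\<rho> u f)"
proof
  fix p
  have "bracket A u v p = mb u v p + P (K u v) p"
    by (simp add: mod_bracket_def)
  then have "anchor A p (bracket A u v p) f = anchor A p (mb u v p) f + anchor A p (P (K u v) p) f"
    using anchor_linear[of p f] assms
    by (simp add: linear_over_def G_fibre mb_closed proj_closed L_contr_closed)
  then show "\<rho> (mb u v) f p = (\<rho> u (\<rho> v f) - \<rho> v (\<rho> u f)) p"
    using \<rho>_bracket[OF assms] assms by (simp add: rho_def anchor_proj_L_contr fun_eq_iff)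
qed

lemma mb_antisym:
  assumes "u \<in> G" "v \<in> G"
  shows "mb v u = - mb u v"
proof -
  let ?s = "bracket A u v + bracket A v u"
  have s: "?s = K u v + K v u"
    using adm assms by (simp add: admissible_def)
  \<comment> \<open>On smooth f the anchor turns the symmetric part into the sum of two opposite
    commutators. On other f it is 0 by the convention for tangent vectors; this case is needed
    because the kernel of the anchor is expressed by equality of functionals.\<close>
  have "anchor A p (?s p) f = 0" for p f
  proof (cases "f \<in> C")
    case True
    have "anchor A p (?s p) f = \<rho> (bracket A u v) f p + \<rho> (bracket A v u) f p"
      using anchor_linear[of p f] assms by (simp add: linear_over_def G_fibre bracket_closed rho_def)
    then show ?thesis
      using True assms by (simp add: \<rho>_bracket)
  next
    case False
    have "?s p \<in> fibre A p"
      using assms by (intro G_fibre G_add bracket_closed)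
    then show ?thesis
      using anchor_tangent False unfolding tangent_space_def by blast
  qed
  then have "P ?s = ?s"
    using assms by (intro proj_kernel G_add bracket_closed) (auto simp: fun_eq_iff)
  then have "P (K u v) + P (K v u) = ?s"
    unfolding s using assms by (simp add: proj_add L_contr_closed)
  then show ?thesis
    by (simp add: mod_bracket_def algebra_simps)
qed

text \<open>
  The Leibniz rule gives locality in the second argument, and anti-symmetry transfers it to the first.
\<close>

lemma mb_local:
  assumes "u \<in> G" "u' \<in> G" "v \<in> G" "v' \<in> G" "same_germ p u u'" "same_germ p v v'"
  shows "mb u v p = mb u' v' p"
proof -
  have right: "mb u v p = mb u v' p" if "u \<in> G" "v \<in> G" "v' \<in> G" "same_germ p v v'" for u v v'
    by (rule local_functional[where F = "\<lambda>v. mb u v p" and scale = scaleR, OF sm G_diff])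
      (use that in \<open>auto simp: mb_add_right mb_leibniz[unfolded fmult_def]\<close>)
  have "mb u v p = - mb v u p"
    using mb_antisym[OF assms(3,1)] by simp
  also have "\<dots> = - mb v u' p"
    using right[OF assms(3,1,2,5)] by simp
  also have "\<dots> = mb u' v p"
    using mb_antisym[OF assms(3,2)] by simp
  also have "\<dots> = mb u' v' p"
    using right[OF assms(2,3,4,6)] .
  finally show ?thesis .
qed

lemma mb_germ:
  assumes "u \<in> G" "u' \<in> G" "v \<in> G" "v' \<in> G" "same_germ p u u'" "same_germ p v v'"
  shows "same_germ p (mb u v) (mb u' v')"
  unfolding same_germ_def
  using same_germ_nearby[OF assms(5)] same_germ_nearby[OF assms(6)]
  by eventually_elim (rule mb_local[OF assms(1-4)])

end

section \<open>Wedge products of a 1-form and a 2-form\<close>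

lemma sum_permutes_3:
  fixes g :: "nat \<Rightarrow> nat \<Rightarrow> nat \<Rightarrow> real"
  shows "(\<Sum>\<sigma> | \<sigma> permutes {..<3}. of_int (sign \<sigma>) * g (\<sigma> 0) (\<sigma> 1) (\<sigma> 2))
    = g 0 1 2 - g 0 2 1 - g 1 0 2 + g 1 2 0 + g 2 0 1 - g 2 1 0"
proof -
  have set: "{..<3::nat} = insert 0 (insert 1 {2})"
    by auto
  have f: "finite {1::nat, 2}" "0 \<notin> {1::nat, 2}" "finite {2::nat}" "1 \<notin> {2::nat}"
    by auto
  show ?thesis
    \<comment> \<open>A permutation of \<open>insert a S\<close> is a transposition involving a,
      composed with a permutation of S. Peeling off 0 and then 1 leaves only the identity on {2};
      the signs come from the transpositions.\<close>
    unfolding set sum_over_permutations_insert[OF f(1,2)] sum_over_permutations_insert[OF f(3,4)] permutes_sing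
    by (simp add: sign_swap_id permutation_swap_id sign_compose sign_id transpose_def)
qed

text \<open>Permutations with the same argument in the slot of \<alpha> come in pairs that exchange
  the arguments of \<beta>. Anti-symmetry makes the paired terms equal, which cancels the factor 1 /
  (1! 2!).\<close>

lemma wedge_1_2:
  assumes "\<beta> [v, u] p = - \<beta> [u, v] p" "\<beta> [w, u] p = - \<beta> [u, w] p" "\<beta> [w, v] p = - \<beta> [v, w] p"
  shows "wedge 1 2 \<alpha> \<beta> [u, v, w] p = \<alpha> [u] p * \<beta> [v, w] p - \<alpha> [v] p * \<beta> [u, w] p + \<alpha> [w] p * \<beta> [u, v] p"
proof -
  let ?g = "\<lambda>i j k. \<alpha> [[u, v, w] ! i] p * \<beta> [[u, v, w] ! j, [u, v, w] ! k] p"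
  have "wedge 1 2 \<alpha> \<beta> [u, v, w] p
      = 1 / 2 * (\<Sum>\<sigma> | \<sigma> permutes {..<3}. of_int (sign \<sigma>) * ?g (\<sigma> 0) (\<sigma> 1) (\<sigma> 2))"
    by (simp add: wedge_def upt_rec mult.assoc numeral_3_eq_3 numeral_2_eq_2)
  then show ?thesis
    unfolding sum_permutes_3[of ?g] using assms by (simp add: numeral_2_eq_2)
qed

lemma wedge_2_1:
  assumes "\<beta> [v, u] p = - \<beta> [u, v] p" "\<beta> [w, u] p = - \<beta> [u, w] p" "\<beta> [w, v] p = - \<beta> [v, w] p"
  shows "wedge 2 1 \<beta> \<alpha> [u, v, w] p = \<beta> [u, v] p * \<alpha> [w] p - \<beta> [u, w] p * \<alpha> [v] p + \<beta> [v, w] p * \<alpha> [u] p"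
proof -
  let ?g = "\<lambda>i j k. \<beta> [[u, v, w] ! i, [u, v, w] ! j] p * \<alpha> [[u, v, w] ! k] p"
  have "wedge 2 1 \<beta> \<alpha> [u, v, w] p
      = 1 / 2 * (\<Sum>\<sigma> | \<sigma> permutes {..<3}. of_int (sign \<sigma>) * ?g (\<sigma> 0) (\<sigma> 1) (\<sigma> 2))"
    by (simp add: wedge_def upt_rec mult.assoc numeral_3_eq_3 numeral_2_eq_2)
  then show ?thesis
    unfolding sum_permutes_3[of ?g] using assms by (simp add: numeral_2_eq_2 algebra_simps)
qed

context connected_algebroid
begin

section \<open>The Bianchi identities for global sections\<close>

lemma torsion_closed: "u \<in> G \<Longrightarrow> v \<in> G \<Longrightarrow> T u v \<in> G"
  by (simp add: torsion_def G_diff nabla_closed mb_closed)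

lemma torsion_antisym: "u \<in> G \<Longrightarrow> v \<in> G \<Longrightarrow> T v u = - T u v"
  using mb_antisym[of u v] by (simp add: torsion_def)

lemma torsion_local:
  assumes "u \<in> G" "u' \<in> G" "v \<in> G" "v' \<in> G" "same_germ p u u'" "same_germ p v v'"
  shows "T u v p = T u' v' p"
  using nabla_local[OF assms] nabla_local[OF assms(3,4,1,2,6,5)] mb_local[OF assms]
  by (simp add: torsion_def)

lemma curvature_closed: "u \<in> G \<Longrightarrow> v \<in> G \<Longrightarrow> w \<in> G \<Longrightarrow> R u v w \<in> G"
  by (simp add: curvature_def G_diff nabla_closed mb_closed)

lemma curvature_antisym: "u \<in> G \<Longrightarrow> v \<in> G \<Longrightarrow> w \<in> G \<Longrightarrow> R v u w = - R u v w"
  using mb_antisym[of u v] by (simp add: curvature_def nabla_uminus_left mb_closed)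

text \<open>The inner \<nabla> and the bracket are differentiated or used as a direction, so they
  enter through their germs.\<close>

lemma curvature_local:
  assumes "u \<in> G" "u' \<in> G" "v \<in> G" "v' \<in> G" "w \<in> G" "w' \<in> G"
    "same_germ p u u'" "same_germ p v v'" "same_germ p w w'"
  shows "R u v w p = R u' v' w' p"
proof -
  have "nabla u (nabla v w) p = nabla u' (nabla v' w') p"
    "nabla v (nabla u w) p = nabla v' (nabla u' w') p"
    "nabla (mb u v) w p = nabla (mb u' v') w' p"
    using assms by (auto intro!: nabla_local nabla_germ mb_germ nabla_closed mb_closed)
  then show ?thesis
    by (simp add: curvature_def)
qed

lemma curvature_add:
  assumes "u \<in> G" "v \<in> G" "w \<in> G" "s \<in> G"
  shows "R u v (w + s) = R u v w + R u v s"
  using assms by (simp add: curvature_def nabla_add_right nabla_closed mb_closed)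

text \<open>The mixed first-order terms cancel in the commutator of \<nabla>_u and \<nabla>_v, and
  the second derivatives of f cancel against the derivative along the bracket by
  \<open>\<rho>_mb\<close>.\<close>

lemma curvature_fmult:
  assumes "u \<in> G" "v \<in> G" "w \<in> G" "f \<in> C"
  shows "R u v (fmult f w) = fmult f (R u v w)"
  using assms
  by (simp add: curvature_def nabla_leibniz nabla_add_right nabla_closed mb_closed \<rho>_closed G_fmult \<rho>_mb)
    (simp add: fmult_def fun_eq_iff algebra_simps)

lemma curvature_components:
  assumes fr: "frame_at p Y \<alpha>" and a: "a < rk A" and cl: "u \<in> G" "v \<in> G" "s \<in> G"
  shows "\<alpha> a p (R u v s p) = (\<Sum>b<rk A. \<alpha> a p (R u v (Y b) p) * \<alpha> b p (s p))"
proof -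
  note fcl = frame_at_closed[OF fr]
  note lin = \<Omega>1_linear[OF fcl(2)[OF a], of p, unfolded linear_over_def]
  have "\<alpha> a p (R u v s p) = (\<Sum>b<rk A. \<alpha> a p (R u v (fmult (\<lambda>q. \<alpha> b q (s q)) (Y b)) p))"
  proof (rule section_expansion[OF fr cl(3), where F = "\<lambda>s. \<alpha> a p (R u v s p)"])
    show "\<alpha> a p (R u v (x + y) p) = \<alpha> a p (R u v x p) + \<alpha> a p (R u v y p)"
      if "x \<in> G" "y \<in> G" for x y
      using lin that cl by (simp add: curvature_add curvature_closed G_fibre)
    show "\<alpha> a p (R u v x p) = \<alpha> a p (R u v y p)" if "x \<in> G" "y \<in> G" "same_germ p x y" for x y
      using curvature_local[OF cl(1,1,2,2) that(1,2) _ _ that(3)] by simp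
  qed
  also have "\<dots> = (\<Sum>b<rk A. \<alpha> a p (R u v (Y b) p) * \<alpha> b p (s p))"
  proof (rule sum.cong)
    fix b assume "b \<in> {..<rk A}"
    then show "\<alpha> a p (R u v (fmult (\<lambda>q. \<alpha> b q (s q)) (Y b)) p) = \<alpha> a p (R u v (Y b) p) * \<alpha> b p (s p)"
      using lin cl fcl by (simp add: curvature_fmult \<Omega>1_smooth) (simp add: fmult_def curvature_closed G_fibre)
  qed simp
  finally show ?thesis .
qed

text \<open>The Leibniz rule splits each frame component: duality retains only the derivative of the
  a-th coefficient, and the remaining terms are the connection form applied to the
  components.\<close>

lemma nabla_components:
  assumes fr: "frame_at p Y \<alpha>" and a: "a < rk A" and cl: "u \<in> G" "s \<in> G"
  shows "\<alpha> a p (nabla u s p) = \<rho> u (\<lambda>q. \<alpha> a q (s q)) p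
    + (\<Sum>b<rk A. \<alpha> a p (nabla u (Y b) p) * \<alpha> b p (s p))"
proof -
  note fcl = frame_at_closed[OF fr]
  note lin = \<Omega>1_linear[OF fcl(2)[OF a], of p, unfolded linear_over_def]
  have "\<alpha> a p (nabla u s p) = (\<Sum>b<rk A. \<alpha> a p (nabla u (fmult (\<lambda>q. \<alpha> b q (s q)) (Y b)) p))"
  proof (rule section_expansion[OF fr cl(2), where F = "\<lambda>s. \<alpha> a p (nabla u s p)"])
    show "\<alpha> a p (nabla u (x + y) p) = \<alpha> a p (nabla u x p) + \<alpha> a p (nabla u y p)"
      if "x \<in> G" "y \<in> G" for x y
      using lin that cl by (simp add: nabla_add_right nabla_closed G_fibre)
    show "\<alpha> a p (nabla u x p) = \<alpha> a p (nabla u y p)" if "x \<in> G" "y \<in> G" "same_germ p x y" for x y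
      using nabla_local[OF cl(1,1) that(1,2) _ that(3)] by simp
  qed
  also have "\<dots> = (\<Sum>b<rk A. (if b = a then \<rho> u (\<lambda>q. \<alpha> a q (s q)) p else 0)
      + \<alpha> a p (nabla u (Y b) p) * \<alpha> b p (s p))"
  proof (rule sum.cong)
    fix b assume b: "b \<in> {..<rk A}"
    let ?f = "\<lambda>q. \<alpha> b q (s q)"
    have "nabla u (fmult ?f (Y b)) p = \<rho> u ?f p *\<^sub>R Y b p + ?f p *\<^sub>R nabla u (Y b) p"
      using b cl fcl by (simp add: nabla_leibniz \<Omega>1_smooth) (simp add: fmult_def)
    then have "\<alpha> a p (nabla u (fmult ?f (Y b)) p)
        = \<rho> u ?f p * \<alpha> a p (Y b p) + ?f p * \<alpha> a p (nabla u (Y b) p)"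
      using lin b cl fcl by (simp add: G_fibre nabla_closed subspace_scale[OF sub])
    then show "\<alpha> a p (nabla u (fmult ?f (Y b)) p) = (if b = a then \<rho> u (\<lambda>q. \<alpha> a q (s q)) p else 0)
        + \<alpha> a p (nabla u (Y b) p) * \<alpha> b p (s p)"
      using frame_at_dual[OF fr a] b by auto
  qed simp
  also have "\<dots> = \<rho> u (\<lambda>q. \<alpha> a q (s q)) p + (\<Sum>b<rk A. \<alpha> a p (nabla u (Y b) p) * \<alpha> b p (s p))"
    using a by (simp add: sum.distrib)
  finally show ?thesis .
qed

text \<open>The exterior derivative in degree one, as an operation on maps from global sections to
  functions; \<open>d2\<close> is its degree-two counterpart.\<close>

definition d1 :: "(('m \<Rightarrow> 'v) \<Rightarrow> 'm \<Rightarrow> real) \<Rightarrow> ('m \<Rightarrow> 'v) \<Rightarrow> ('m \<Rightarrow> 'v) \<Rightarrow> 'm \<Rightarrow> real" where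
  "d1 \<omega> u v = \<rho> u (\<omega> v) - \<rho> v (\<omega> u) - \<omega> (mb u v)"

definition d2 :: "(('m \<Rightarrow> 'v) \<Rightarrow> ('m \<Rightarrow> 'v) \<Rightarrow> 'm \<Rightarrow> real)
    \<Rightarrow> ('m \<Rightarrow> 'v) \<Rightarrow> ('m \<Rightarrow> 'v) \<Rightarrow> ('m \<Rightarrow> 'v) \<Rightarrow> 'm \<Rightarrow> real" where
  "d2 \<Theta> u v w = \<rho> u (\<Theta> v w) - \<rho> v (\<Theta> u w) + \<rho> w (\<Theta> u v)
     - \<Theta> (mb u v) w + \<Theta> (mb u w) v - \<Theta> (mb v w) u"

text \<open>The exterior covariant derivative of a 2-form with values in E: the formula of
  \<open>d2\<close> with \<rho> replaced by \<nabla>.\<close>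

definition covariant_d :: "(('m \<Rightarrow> 'v) \<Rightarrow> ('m \<Rightarrow> 'v) \<Rightarrow> 'm \<Rightarrow> 'v)
    \<Rightarrow> ('m \<Rightarrow> 'v) \<Rightarrow> ('m \<Rightarrow> 'v) \<Rightarrow> ('m \<Rightarrow> 'v) \<Rightarrow> 'm \<Rightarrow> 'v" where
  "covariant_d \<Theta> u v w = nabla u (\<Theta> v w) - nabla v (\<Theta> u w) + nabla w (\<Theta> u v)
     - \<Theta> (mb u v) w + \<Theta> (mb u w) v - \<Theta> (mb v w) u"

lemma d1_closed:
  assumes "\<And>u. u \<in> G \<Longrightarrow> \<omega> u \<in> C" "u \<in> G" "v \<in> G"
  shows "d1 \<omega> u v \<in> C"
  unfolding d1_def using assms by (intro C_diff \<rho>_closed mb_closed) (auto intro: mb_closed)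

text \<open>The square of the exterior derivative is the obstruction to the Jacobi identity.\<close>

lemma d2_d1:
  assumes "\<And>u. u \<in> G \<Longrightarrow> \<omega> u \<in> C" "u \<in> G" "v \<in> G" "w \<in> G"
  shows "d2 (d1 \<omega>) u v w = \<omega> (mb (mb u v) w) - \<omega> (mb (mb u w) v) + \<omega> (mb (mb v w) u)"
  using assms by (simp add: d2_def d1_def \<rho>_diff \<rho>_mb \<rho>_closed C_diff mb_closed)

text \<open>Each of the three \<nabla>-terms is a derivative of components plus a connection term;
  the connection terms assemble into the wedge with the connection form, while the bracket terms
  agree already.\<close>

lemma covariant_d_components:
  assumes fr: "frame_at p Y \<alpha>" and a: "a < rk A" and cl: "u \<in> G" "v \<in> G" "w \<in> G"
    and \<Theta>: "\<And>x y. x \<in> G \<Longrightarrow> y \<in> G \<Longrightarrow> \<Theta> x y \<in> G"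
  shows "d2 (\<lambda>x y q. \<alpha> a q (\<Theta> x y q)) u v w p
    + (\<Sum>b<rk A. \<alpha> a p (nabla u (Y b) p) * \<alpha> b p (\<Theta> v w p) - \<alpha> a p (nabla v (Y b) p) * \<alpha> b p (\<Theta> u w p)
        + \<alpha> a p (nabla w (Y b) p) * \<alpha> b p (\<Theta> u v p))
    = \<alpha> a p (covariant_d \<Theta> u v w p)"
proof -
  show ?thesis
    using cl \<Theta> frame_at_closed(2)[OF fr a]
    by (simp add: covariant_d_def d2_def \<Omega>1_at_add \<Omega>1_at_diff G_fibre subspace_add[OF sub] subspace_diff[OF sub]
        nabla_closed mb_closed nabla_components[OF fr a] sum.distrib sum_subtractf)
qed

text \<open>The derivatives of a bracket, such as \<nabla>_w [u,v], occur twice with opposite signs: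
  once from differentiating the torsion and once from the torsion with a bracket argument.
  Derivatives along a bracket complete the curvatures.\<close>

lemma covariant_d_torsion:
  assumes "u \<in> G" "v \<in> G" "w \<in> G"
  shows "covariant_d T u v w = (R u v w - R u w v + R v w u)
    + (mb (mb u v) w - mb (mb u w) v + mb (mb v w) u)"
  using assms
  by (simp add: covariant_d_def torsion_def curvature_def nabla_diff_right nabla_closed mb_closed G_diff)

text \<open>The same cancellation with \<nabla>_w \<nabla>_[u,v] s in place of \<nabla>_w [u,v]. The
  triple derivatives are regrouped by their innermost one, which becomes the argument of R.\<close>

lemma covariant_d_curvature:
  assumes "u \<in> G" "v \<in> G" "w \<in> G" "s \<in> G"
  shows "covariant_d (\<lambda>x y. R x y s) u v w = (R u v (nabla w s) - R u w (nabla v s) + R v w (nabla u s))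
    + (nabla (mb (mb u v) w) s - nabla (mb (mb u w) v) s + nabla (mb (mb v w) u) s)"
  using assms
  by (simp add: covariant_d_def curvature_def nabla_diff_right nabla_closed mb_closed G_diff)

section \<open>Forms on an open set\<close>

definition rep :: "'m \<Rightarrow> ('m \<Rightarrow> 'v) \<Rightarrow> ('m \<Rightarrow> 'v) \<Rightarrow> bool" where
  "rep p u u' \<longleftrightarrow> u' \<in> G \<and> same_germ p u' u"

lemma rep_nearby: "rep p u u' \<Longrightarrow> \<forall>\<^sub>F q in nhds p. rep q u u'"
  unfolding rep_def using same_germ_nearby by (auto elim: eventually_mono)

lemma rep_exists: "open U \<Longrightarrow> p \<in> U \<Longrightarrow> u \<in> sections A U \<Longrightarrow> \<exists>u'. rep p u u'"
  using sections_ext[OF vb] by (auto simp: rep_def same_germ_def)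

lemma rep_ext_sec:
  assumes "rep p u u'"
  shows "ext_sec A p u \<in> G" "same_germ p (ext_sec A p u) u'"
  using germ_ext_works[of u' G p u] assms same_germ_trans same_germ_sym unfolding rep_def by blast+

text \<open>The restricted bracket takes new extensions at every point; locality at each point near
  p shows that the single global section \<open>mb u' v'\<close> has the same germ, so the result
  can be used as an argument again.\<close>

lemma restr2_mb:
  assumes "rep p u u'" "rep p v v'"
  shows "rep p (restr2 A mb u v) (mb u' v')"
  unfolding rep_def same_germ_def
proof (intro conjI)
  show "mb u' v' \<in> G"
    using assms by (simp add: rep_def mb_closed)
  show "\<forall>\<^sub>F q in nhds p. mb u' v' q = restr2 A mb u v q"
    using rep_nearby[OF assms(1)] rep_nearby[OF assms(2)]
  proof eventually_elim
    case (elim q)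
    show ?case
      unfolding restr2_def
      using rep_ext_sec[OF elim(1)] rep_ext_sec[OF elim(2)] elim
      by (intro mb_local) (auto simp: rep_def same_germ_sym)
  qed
qed

text \<open>\<open>rho_loc\<close> differentiates a chosen extension of f, so equality of the germs
  of g and f is required, not just of their values at p.\<close>

lemma rho_loc_rep:
  assumes "rep p u u'" "g \<in> C" "same_germ p g f"
  shows "rho_loc A u f p = \<rho> u' g p"
proof -
  have "u p = u' p"
    using assms(1) same_germ_at by (fastforce simp: rep_def)
  moreover have "\<rho> u' (germ_ext C p f) p = \<rho> u' g p"
    using germ_ext_works[OF assms(2,3)] assms
    by (intro \<rho>_local) (auto simp: rep_def intro: same_germ_trans same_germ_sym)
  ultimately show ?thesis
    by (simp add: rho_loc_def rho_def)
qed

text \<open>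
  Forms on \<open>U\<close> are functions of local sections; a representing map computes the same values from
  global sections with the same germs.
\<close>

definition represents1 :: "'m set \<Rightarrow> ('m, 'v) form \<Rightarrow> (('m \<Rightarrow> 'v) \<Rightarrow> 'm \<Rightarrow> real) \<Rightarrow> bool" where
  "represents1 N \<Theta> \<theta> \<longleftrightarrow> (\<forall>u\<in>G. \<theta> u \<in> C) \<and> (\<forall>q\<in>N. \<forall>u u'. rep q u u' \<longrightarrow> \<Theta> [u] q = \<theta> u' q)"

definition represents2 :: "'m set \<Rightarrow> ('m, 'v) form \<Rightarrow> (('m \<Rightarrow> 'v) \<Rightarrow> ('m \<Rightarrow> 'v) \<Rightarrow> 'm \<Rightarrow> real) \<Rightarrow> bool" where
  "represents2 N \<Theta> \<theta> \<longleftrightarrow> (\<forall>u\<in>G. \<forall>v\<in>G. \<theta> u v \<in> C) \<and>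
     (\<forall>q\<in>N. \<forall>u u' v v'. rep q u u' \<longrightarrow> rep q v v' \<longrightarrow> \<Theta> [u, v] q = \<theta> u' v' q)"

text \<open>Openness of N turns the agreement at its points into the germ equality that
  \<open>rho_loc_rep\<close> needs.\<close>

lemma represents1_germ:
  assumes "represents1 N \<Theta> \<theta>" "open N" "p \<in> N" "rep p u u'"
  shows "same_germ p (\<theta> u') (\<Theta> [u])"
  unfolding same_germ_def
  using eventually_nhds_in_open[OF assms(2,3)] rep_nearby[OF assms(4)]
  by eventually_elim (use assms(1) in \<open>auto simp: represents1_def\<close>)

lemma represents2_germ:
  assumes "represents2 N \<Theta> \<theta>" "open N" "p \<in> N" "rep p u u'" "rep p v v'"
  shows "same_germ p (\<theta> u' v') (\<Theta> [u, v])"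
  unfolding same_germ_def
  using eventually_nhds_in_open[OF assms(2,3)] rep_nearby[OF assms(4)] rep_nearby[OF assms(5)]
  by eventually_elim (use assms(1) in \<open>auto simp: represents2_def\<close>)

text \<open>The conclusion holds on all of N, not only at one point, so that a second exterior
  derivative can be taken.\<close>

lemma ext_deriv_1:
  assumes r: "represents1 N \<Theta> \<theta>" and N: "open N"
  shows "represents2 N (ext_deriv A P nabla \<Theta>) (d1 \<theta>)"
  unfolding represents2_def
proof (safe)
  show "d1 \<theta> u v \<in> C" if "u \<in> G" "v \<in> G" for u v
    using r that by (intro d1_closed) (auto simp: represents1_def)
  fix q u u' v v' assume q: "q \<in> N" and u: "rep q u u'" and v: "rep q v v'"
  have "rho_loc A u (\<Theta> [v]) q = \<rho> u' (\<theta> v') q" "rho_loc A v (\<Theta> [u]) q = \<rho> v' (\<theta> u') q"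
    using r u v represents1_germ[OF r N q] by (auto intro!: rho_loc_rep simp: represents1_def rep_def)
  moreover have "\<Theta> [restr2 A mb u v] q = \<theta> (mb u' v') q"
    using r q restr2_mb[OF u v] by (auto simp: represents1_def)
  ultimately show "ext_deriv A P nabla \<Theta> [u, v] q = d1 \<theta> u' v' q"
    by (simp add: ext_deriv_def d1_def lessThan_Suc nths_Cons numeral_2_eq_2)
qed

lemma ext_deriv_2:
  assumes r: "represents2 N \<Theta> \<theta>" and N: "open N" and p: "p \<in> N"
    and u: "rep p u u'" and v: "rep p v v'" and w: "rep p w w'"
  shows "ext_deriv A P nabla \<Theta> [u, v, w] p = d2 \<theta> u' v' w' p"
proof -
  have "rho_loc A x (\<Theta> [y, z]) p = \<rho> x' (\<theta> y' z') p" if "rep p x x'" "rep p y y'" "rep p z z'" for x x' y y' z z'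
    using r that represents2_germ[OF r N p that(2,3)]
    by (auto intro!: rho_loc_rep simp: represents2_def rep_def)
  moreover have "\<Theta> [restr2 A mb x y, z] p = \<theta> (mb x' y') z' p" if "rep p x x'" "rep p y y'" "rep p z z'" for x x' y y' z z'
    using r p that restr2_mb[OF that(1,2)] by (auto simp: represents2_def)
  ultimately show ?thesis
    using u v w by (simp add: ext_deriv_def d2_def lessThan_Suc nths_Cons numeral_3_eq_3)
qed


text \<open>A whole neighbourhood N of agreement is required because the component forms are
  differentiated. The vectors must agree as germs at each point of N, since \<nabla> differentiates
  them; for covectors the values suffice.\<close>

lemma adapted_frame:
  assumes fr: "local_frame A U X" and co: "dual_coframe A U X e" and p: "p \<in> U"
  obtains N Y \<alpha> where "open N" "p \<in> N" "frame_at p Y \<alpha>"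
    "\<And>q a. q \<in> N \<Longrightarrow> a < rk A \<Longrightarrow> rep q (X a) (Y a) \<and> \<alpha> a q = e a q"
proof -
  obtain Y where Y: "\<forall>a<rk A. Y a \<in> G \<and> same_germ p (Y a) (X a)"
    using extend_frame(1)[OF fr co p] by metis
  obtain \<alpha> where \<alpha>: "\<forall>a<rk A. \<alpha> a \<in> \<Omega>1 \<and> same_germ p (\<alpha> a) (e a)"
    using extend_frame(2)[OF fr co p] by metis
  have "\<forall>\<^sub>F q in nhds p. \<forall>a\<in>{..<rk A}. same_germ q (Y a) (X a) \<and> \<alpha> a q = e a q"
    using Y \<alpha> by (auto intro!: eventually_ball_finite eventually_conj same_germ_nearby simp: same_germ_def[of p "\<alpha> _"])
  then obtain N where "open N" "p \<in> N"
    "\<forall>q\<in>N. \<forall>a\<in>{..<rk A}. same_germ q (Y a) (X a) \<and> \<alpha> a q = e a q"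
    unfolding eventually_nhds by blast
  moreover have "frame_at p Y \<alpha>"
    using Y \<alpha> by (intro frame_at_extension[OF fr co p]) auto
  ultimately show ?thesis
    using that[of N Y \<alpha>] Y by (auto simp: rep_def)
qed

section \<open>Component forms in an adapted frame\<close>

context
  fixes N X Y \<alpha> e p
  assumes frame: "frame_at p Y \<alpha>"
    and frame_rep: "\<And>q a. q \<in> N \<Longrightarrow> a < rk A \<Longrightarrow> rep q (X a) (Y a) \<and> \<alpha> a q = e a q"
begin

lemma coframe_form_rep:
  assumes "a < rk A"
  shows "represents1 N (coframe_form e a) (\<lambda>u q. \<alpha> a q (u q))"
  unfolding represents1_def coframe_form_def
proof (safe)
  show "(\<lambda>q. \<alpha> a q (u q)) \<in> C" if "u \<in> G" for u
    using frame_at_closed[OF frame assms] that by (intro \<Omega>1_smooth)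
  show "e a q (([u] ! 0) q) = \<alpha> a q (u' q)" if "q \<in> N" "rep q u u'" for q u u'
    using that frame_rep[OF that(1) assms] same_germ_at by (fastforce simp: rep_def)
qed

lemma connection_form_rep:
  assumes "a < rk A" "b < rk A"
  shows "represents1 N (connection_form A nabla X e a b) (\<lambda>u q. \<alpha> a q (nabla u (Y b) q))"
  unfolding represents1_def connection_form_def
proof (safe)
  show "(\<lambda>q. \<alpha> a q (nabla u (Y b) q)) \<in> C" if "u \<in> G" for u
    using frame_at_closed[OF frame] assms that by (intro \<Omega>1_smooth nabla_closed)
  fix q u u' assume q: "q \<in> N" and u: "rep q u u'"
  have X: "rep q (X b) (Y b)" and \<alpha>: "\<alpha> a q = e a q"
    using frame_rep q assms by auto
  have "restr2 A nabla u (X b) q = nabla u' (Y b) q"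
    unfolding restr2_def using rep_ext_sec[OF u] rep_ext_sec[OF X] u X
    by (intro nabla_local) (auto simp: rep_def)
  then show "e a q (restr2 A nabla ([u] ! 0) (X b) q) = \<alpha> a q (nabla u' (Y b) q)"
    using \<alpha> by simp
qed

lemma torsion_form_rep:
  assumes "a < rk A"
  shows "represents2 N (torsion_form A P nabla e a) (\<lambda>u v q. \<alpha> a q (T u v q))"
  unfolding represents2_def torsion_form_def
proof (safe)
  show "(\<lambda>q. \<alpha> a q (T u v q)) \<in> C" if "u \<in> G" "v \<in> G" for u v
    using frame_at_closed[OF frame] assms that by (intro \<Omega>1_smooth torsion_closed)
  fix q u u' v v' assume q: "q \<in> N" and u: "rep q u u'" and v: "rep q v v'"
  have "restr2 A T u v q = T u' v' q"
    unfolding restr2_def using rep_ext_sec[OF u] rep_ext_sec[OF v] u v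
    by (intro torsion_local) (auto simp: rep_def)
  then show "e a q (restr2 A T ([u, v] ! 0) ([u, v] ! 1) q) = \<alpha> a q (T u' v' q)"
    using frame_rep q assms by simp
qed

lemma curvature_form_rep:
  assumes "a < rk A" "b < rk A"
  shows "represents2 N (curvature_form A P nabla X e a b) (\<lambda>u v q. \<alpha> a q (R u v (Y b) q))"
  unfolding represents2_def curvature_form_def
proof (safe)
  show "(\<lambda>q. \<alpha> a q (R u v (Y b) q)) \<in> C" if "u \<in> G" "v \<in> G" for u v
    using frame_at_closed[OF frame] assms that by (intro \<Omega>1_smooth curvature_closed)
  fix q u u' v v' assume q: "q \<in> N" and u: "rep q u u'" and v: "rep q v v'"
  have X: "rep q (X b) (Y b)" and \<alpha>: "\<alpha> a q = e a q"
    using frame_rep q assms by auto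
  have "restr3 A R u v (X b) q = R u' v' (Y b) q"
    unfolding restr3_def using rep_ext_sec[OF u] rep_ext_sec[OF v] rep_ext_sec[OF X] u v X
    by (intro curvature_local) (auto simp: rep_def)
  then show "e a q (restr3 A R ([u, v] ! 0) ([u, v] ! 1) (X b) q) = \<alpha> a q (R u' v' (Y b) q)"
    using \<alpha> by simp
qed

section \<open>The identities at a single point\<close>

context
  fixes u v w u' v' w'
  assumes N: "open N" "p \<in> N"
    and u: "rep p u u'" and v: "rep p v v'" and w: "rep p w w'"
begin

private lemma cl: "u' \<in> G" "v' \<in> G" "w' \<in> G"
  using u v w by (simp_all add: rep_def)

text \<open>With all forms evaluated on fixed representatives, both sides become the a-th component
  at p of the global identity \<open>covariant_d_torsion\<close>: the wedge with e^b sums the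
  components of R, and the double brackets give d^2 of the coframe.\<close>

lemma bianchi_torsion:
  assumes a: "a < rk A"
  shows "ext_deriv A P nabla (torsion_form A P nabla e a) [u, v, w] p
      + (\<Sum>b<rk A. wedge 1 2 (connection_form A nabla X e a b) (torsion_form A P nabla e b) [u, v, w] p)
    = (\<Sum>b<rk A. wedge 2 1 (curvature_form A P nabla X e a b) (coframe_form e b) [u, v, w] p)
      + ext_deriv A P nabla (ext_deriv A P nabla (coframe_form e a)) [u, v, w] p"
proof -
  note closed = cl torsion_closed curvature_closed mb_closed frame_at_closed[OF frame] G_fibre
  have \<tau>: "torsion_form A P nabla e b [x, y] p = \<alpha> b p (T x' y' p)"
    if "b < rk A" "rep p x x'" "rep p y y'" for b x x' y y'
    using torsion_form_rep[OF that(1)] N(2) that by (simp add: represents2_def)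
  have \<kappa>: "curvature_form A P nabla X e a b [x, y] p = \<alpha> a p (R x' y' (Y b) p)"
    if "b < rk A" "rep p x x'" "rep p y y'" for b x x' y y'
    using curvature_form_rep[OF a that(1)] N(2) that by (simp add: represents2_def)
  have \<omega>: "connection_form A nabla X e a b [x] p = \<alpha> a p (nabla x' (Y b) p)"
    if "b < rk A" "rep p x x'" for b x x'
    using connection_form_rep[OF a that(1)] N(2) that by (simp add: represents1_def)
  have \<epsilon>: "coframe_form e b [x] p = \<alpha> b p (x' p)" if "b < rk A" "rep p x x'" for b x x'
    using coframe_form_rep[OF that(1)] N(2) that by (simp add: represents1_def)
  have "wedge 1 2 (connection_form A nabla X e a b) (torsion_form A P nabla e b) [u, v, w] p
      = \<alpha> a p (nabla u' (Y b) p) * \<alpha> b p (T v' w' p) - \<alpha> a p (nabla v' (Y b) p) * \<alpha> b p (T u' w' p)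
        + \<alpha> a p (nabla w' (Y b) p) * \<alpha> b p (T u' v' p)" if b: "b < rk A" for b
    using b u v w
    by (subst wedge_1_2) (simp_all add: \<omega> \<tau> \<Omega>1_at_uminus closed
        torsion_antisym[OF cl(1,2)] torsion_antisym[OF cl(1,3)] torsion_antisym[OF cl(2,3)])
  then have "ext_deriv A P nabla (torsion_form A P nabla e a) [u, v, w] p
      + (\<Sum>b<rk A. wedge 1 2 (connection_form A nabla X e a b) (torsion_form A P nabla e b) [u, v, w] p)
    = \<alpha> a p (covariant_d T u' v' w' p)"
    using ext_deriv_2[OF torsion_form_rep[OF a] N u v w]
      covariant_d_components[OF frame a cl torsion_closed] by simp
  moreover have "wedge 2 1 (curvature_form A P nabla X e a b) (coframe_form e b) [u, v, w] p
      = \<alpha> a p (R u' v' (Y b) p) * \<alpha> b p (w' p) - \<alpha> a p (R u' w' (Y b) p) * \<alpha> b p (v' p)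
        + \<alpha> a p (R v' w' (Y b) p) * \<alpha> b p (u' p)" if b: "b < rk A" for b
    using a b u v w
    by (subst wedge_2_1) (simp_all add: \<epsilon> \<kappa> \<Omega>1_at_uminus closed
        curvature_antisym[OF cl(1,2)] curvature_antisym[OF cl(1,3)] curvature_antisym[OF cl(2,3)])
  then have "(\<Sum>b<rk A. wedge 2 1 (curvature_form A P nabla X e a b) (coframe_form e b) [u, v, w] p)
      = \<alpha> a p (R u' v' w' p) - \<alpha> a p (R u' w' v' p) + \<alpha> a p (R v' w' u' p)"
    using cl by (simp add: curvature_components[OF frame a] sum.distrib sum_subtractf)
  moreover have "ext_deriv A P nabla (ext_deriv A P nabla (coframe_form e a)) [u, v, w] p
      = \<alpha> a p (mb (mb u' v') w' p) - \<alpha> a p (mb (mb u' w') v' p) + \<alpha> a p (mb (mb v' w') u' p)"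
    using ext_deriv_2[OF ext_deriv_1[OF coframe_form_rep[OF a] N(1)] N u v w]
      d2_d1[of "\<lambda>s q. \<alpha> a q (s q)", OF \<Omega>1_smooth[OF frame_at_closed(2)[OF frame a]] cl] by simp
  ultimately show ?thesis
    using closed a by (simp add: covariant_d_torsion \<Omega>1_at_add \<Omega>1_at_diff subspace_add[OF sub] subspace_diff[OF sub])
qed

text \<open>The a-th component at p of \<open>covariant_d_curvature\<close> with s = Y_b, whose
  double-bracket terms are d^2 of the connection form.\<close>

lemma bianchi_curvature:
  assumes a: "a < rk A" and b: "b < rk A"
  shows "ext_deriv A P nabla (curvature_form A P nabla X e a b) [u, v, w] p
      + (\<Sum>c<rk A. wedge 1 2 (connection_form A nabla X e a c) (curvature_form A P nabla X e c b) [u, v, w] p)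
    = (\<Sum>c<rk A. wedge 2 1 (curvature_form A P nabla X e a c) (connection_form A nabla X e c b) [u, v, w] p)
      + ext_deriv A P nabla (ext_deriv A P nabla (connection_form A nabla X e a b)) [u, v, w] p"
proof -
  note Y = frame_at_closed(1)[OF frame b]
  note closed = cl nabla_closed curvature_closed mb_closed frame_at_closed[OF frame] G_fibre
  have \<kappa>: "curvature_form A P nabla X e c d [x, y] p = \<alpha> c p (R x' y' (Y d) p)"
    if "c < rk A" "d < rk A" "rep p x x'" "rep p y y'" for c d x x' y y'
    using curvature_form_rep[OF that(1,2)] N(2) that by (simp add: represents2_def)
  have \<omega>: "connection_form A nabla X e c d [x] p = \<alpha> c p (nabla x' (Y d) p)"
    if "c < rk A" "d < rk A" "rep p x x'" for c d x x'
    using connection_form_rep[OF that(1,2)] N(2) that by (simp add: represents1_def)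
  have "wedge 1 2 (connection_form A nabla X e a c) (curvature_form A P nabla X e c b) [u, v, w] p
      = \<alpha> a p (nabla u' (Y c) p) * \<alpha> c p (R v' w' (Y b) p) - \<alpha> a p (nabla v' (Y c) p) * \<alpha> c p (R u' w' (Y b) p)
        + \<alpha> a p (nabla w' (Y c) p) * \<alpha> c p (R u' v' (Y b) p)" if c: "c < rk A" for c
    using a b c u v w
    by (subst wedge_1_2) (simp_all add: \<omega> \<kappa> \<Omega>1_at_uminus closed
        curvature_antisym[OF cl(1,2)] curvature_antisym[OF cl(1,3)] curvature_antisym[OF cl(2,3)])
  then have "ext_deriv A P nabla (curvature_form A P nabla X e a b) [u, v, w] p
      + (\<Sum>c<rk A. wedge 1 2 (connection_form A nabla X e a c) (curvature_form A P nabla X e c b) [u, v, w] p)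
    = \<alpha> a p (covariant_d (\<lambda>x y. R x y (Y b)) u' v' w' p)"
    using ext_deriv_2[OF curvature_form_rep[OF a b] N u v w]
      covariant_d_components[OF frame a cl, of "\<lambda>x y. R x y (Y b)"] closed b by simp
  moreover have "wedge 2 1 (curvature_form A P nabla X e a c) (connection_form A nabla X e c b) [u, v, w] p
      = \<alpha> a p (R u' v' (Y c) p) * \<alpha> c p (nabla w' (Y b) p) - \<alpha> a p (R u' w' (Y c) p) * \<alpha> c p (nabla v' (Y b) p)
        + \<alpha> a p (R v' w' (Y c) p) * \<alpha> c p (nabla u' (Y b) p)" if c: "c < rk A" for c
    using a b c u v w
    by (subst wedge_2_1) (simp_all add: \<omega> \<kappa> \<Omega>1_at_uminus closed
        curvature_antisym[OF cl(1,2)] curvature_antisym[OF cl(1,3)] curvature_antisym[OF cl(2,3)])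
  \<comment> \<open>The connection form supplies the components of the derivatives of Y_b, so
    summing over c applies R to the derivative itself, by its linearity in the last
    argument.\<close>
  then have "(\<Sum>c<rk A. wedge 2 1 (curvature_form A P nabla X e a c) (connection_form A nabla X e c b) [u, v, w] p)
      = \<alpha> a p (R u' v' (nabla w' (Y b)) p) - \<alpha> a p (R u' w' (nabla v' (Y b)) p)
        + \<alpha> a p (R v' w' (nabla u' (Y b)) p)"
    by (simp add: curvature_components[OF frame a cl(1,2) nabla_closed[OF cl(3) Y]]
        curvature_components[OF frame a cl(1,3) nabla_closed[OF cl(2) Y]]
        curvature_components[OF frame a cl(2,3) nabla_closed[OF cl(1) Y]] sum.distrib sum_subtractf)
  moreover have "ext_deriv A P nabla (ext_deriv A P nabla (connection_form A nabla X e a b)) [u, v, w] p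
      = \<alpha> a p (nabla (mb (mb u' v') w') (Y b) p) - \<alpha> a p (nabla (mb (mb u' w') v') (Y b) p)
        + \<alpha> a p (nabla (mb (mb v' w') u') (Y b) p)"
    using ext_deriv_2[OF ext_deriv_1[OF connection_form_rep[OF a b] N(1)] N u v w]
      d2_d1[of "\<lambda>s q. \<alpha> a q (nabla s (Y b) q)", OF _ cl] \<Omega>1_smooth[OF frame_at_closed(2)[OF frame a]] closed b
    by simp
  ultimately show ?thesis
    using closed a b
    by (simp add: covariant_d_curvature \<Omega>1_at_add \<Omega>1_at_diff subspace_add[OF sub] subspace_diff[OF sub])
qed

end

end

end

theorem proposition3p12:
  fixes A :: "('m::{t2_space,second_countable_topology}, 'a::real_inner, 'v::real_vector) algebroid"
    and P :: "('m \<Rightarrow> 'v) \<Rightarrow> 'm \<Rightarrow> 'v"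
    and nabla :: "('m \<Rightarrow> 'v) \<Rightarrow> ('m \<Rightarrow> 'v) \<Rightarrow> 'm \<Rightarrow> 'v"
    and X :: "nat \<Rightarrow> 'm \<Rightarrow> 'v"
    and e :: "nat \<Rightarrow> 'm \<Rightarrow> 'v \<Rightarrow> real"
  assumes "local_pre_leibniz_algebroid A" and "regular A"
    and "locality_projector A P"
    and "linear_connection A nabla" and "admissible A nabla"
    and "local_frame A U X" and "dual_coframe A U X e"
  shows
    "(\<forall>a<rk A. forms_eq A U 3
        (ext_deriv A P nabla (torsion_form A P nabla e a)
          + (\<Sum>b<rk A. wedge 1 2 (connection_form A nabla X e a b) (torsion_form A P nabla e b)))
        ((\<Sum>b<rk A. wedge 2 1 (curvature_form A P nabla X e a b) (coframe_form e b))
          + ext_deriv A P nabla (ext_deriv A P nabla (coframe_form e a)))) \<and>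
     (\<forall>a<rk A. \<forall>b<rk A. forms_eq A U 3
        (ext_deriv A P nabla (curvature_form A P nabla X e a b)
          + (\<Sum>c<rk A. wedge 1 2 (connection_form A nabla X e a c) (curvature_form A P nabla X e c b)))
        ((\<Sum>c<rk A. wedge 2 1 (curvature_form A P nabla X e a c) (connection_form A nabla X e c b))
          + ext_deriv A P nabla (ext_deriv A P nabla (connection_form A nabla X e a b))))"
proof -
  interpret connected_algebroid A P nabla
    by unfold_locales fact+
  \<comment> \<open>Equality of 3-forms is tested at one point on three local sections, so all
    representatives and the frame may be chosen anew for each point.\<close>
  have reps: "\<exists>u v w u' v' w' N Y \<alpha>. vs = [u, v, w] \<and> rep p u u' \<and> rep p v v' \<and> rep p w w' \<and>
      open N \<and> p \<in> N \<and> frame_at p Y \<alpha> \<and> (\<forall>q\<in>N. \<forall>a<rk A. rep q (X a) (Y a) \<and> \<alpha> a q = e a q)"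
    if vs: "length vs = 3" "set vs \<subseteq> sections A U" and p: "p \<in> U" for vs p
  proof -
    obtain u v w where uvw: "vs = [u, v, w]"
      using vs(1) by (auto simp: numeral_3_eq_3 length_Suc_conv)
    have "open U"
      using assms(6) by (simp add: local_frame_def)
    then obtain u' v' w' where "rep p u u'" "rep p v v'" "rep p w w'"
      using rep_exists[OF _ p] vs(2) uvw by (metis insert_subset list.simps(15))
    moreover obtain N Y \<alpha> where "open N" "p \<in> N" "frame_at p Y \<alpha>"
      "\<And>q a. q \<in> N \<Longrightarrow> a < rk A \<Longrightarrow> rep q (X a) (Y a) \<and> \<alpha> a q = e a q"
      using adapted_frame[OF assms(6,7) p] by blast
    ultimately show ?thesis
      using uvw by blast
  qed
  show ?thesis
  proof (intro conjI allI impI)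
    fix a assume a: "a < rk A"
    show "forms_eq A U 3
        (ext_deriv A P nabla (torsion_form A P nabla e a)
          + (\<Sum>b<rk A. wedge 1 2 (connection_form A nabla X e a b) (torsion_form A P nabla e b)))
        ((\<Sum>b<rk A. wedge 2 1 (curvature_form A P nabla X e a b) (coframe_form e b))
          + ext_deriv A P nabla (ext_deriv A P nabla (coframe_form e a)))"
      unfolding forms_eq_def
    proof (intro allI impI ballI)
      fix vs p assume "length vs = 3" "set vs \<subseteq> sections A U" "p \<in> U"
      from reps[OF this] obtain u v w u' v' w' N Y \<alpha> where vs: "vs = [u, v, w]"
        and r: "rep p u u'" "rep p v v'" "rep p w w'" and N: "open N" "p \<in> N" and fr: "frame_at p Y \<alpha>"
        and fr': "\<forall>q\<in>N. \<forall>a<rk A. rep q (X a) (Y a) \<and> \<alpha> a q = e a q"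
        by blast
      show "(ext_deriv A P nabla (torsion_form A P nabla e a)
          + (\<Sum>b<rk A. wedge 1 2 (connection_form A nabla X e a b) (torsion_form A P nabla e b))) vs p =
        ((\<Sum>b<rk A. wedge 2 1 (curvature_form A P nabla X e a b) (coframe_form e b))
          + ext_deriv A P nabla (ext_deriv A P nabla (coframe_form e a))) vs p"
        unfolding vs plus_fun_apply sum_fun_apply
        using bianchi_torsion[OF fr _ N r a] fr' by blast
    qed
  next
    fix a b assume a: "a < rk A" and b: "b < rk A"
    show "forms_eq A U 3
        (ext_deriv A P nabla (curvature_form A P nabla X e a b)
          + (\<Sum>c<rk A. wedge 1 2 (connection_form A nabla X e a c) (curvature_form A P nabla X e c b)))
        ((\<Sum>c<rk A. wedge 2 1 (curvature_form A P nabla X e a c) (connection_form A nabla X e c b))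
          + ext_deriv A P nabla (ext_deriv A P nabla (connection_form A nabla X e a b)))"
      unfolding forms_eq_def
    proof (intro allI impI ballI)
      fix vs p assume "length vs = 3" "set vs \<subseteq> sections A U" "p \<in> U"
      from reps[OF this] obtain u v w u' v' w' N Y \<alpha> where vs: "vs = [u, v, w]"
        and r: "rep p u u'" "rep p v v'" "rep p w w'" and N: "open N" "p \<in> N" and fr: "frame_at p Y \<alpha>"
        and fr': "\<forall>q\<in>N. \<forall>a<rk A. rep q (X a) (Y a) \<and> \<alpha> a q = e a q"
        by blast
      show "(ext_deriv A P nabla (curvature_form A P nabla X e a b)
          + (\<Sum>c<rk A. wedge 1 2 (connection_form A nabla X e a c) (curvature_form A P nabla X e c b))) vs p =
        ((\<Sum>c<rk A. wedge 2 1 (curvature_form A P nabla X e a c) (connection_form A nabla X e c b))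
          + ext_deriv A P nabla (ext_deriv A P nabla (connection_form A nabla X e a b))) vs p"
        unfolding vs plus_fun_apply sum_fun_apply
        using bianchi_curvature[OF fr _ N r a b] fr' by blast
    qed
  qed
qed

end
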